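(* Let $\mathrm{GL}(2)\times\mathrm{GL}(2)\times\mathrm{GL}(2)$ act on $\mathbb{R}^{2\times2\times2}$ by $(U,V,W)\cdot\mathcal{T}=\mathcal{T}\times_1U\times_2V\times_3W$. The space $\mathbb{R}^{2\times2\times2}$ is partitioned into the eight orbits $D_0,D_1,D_2,D_2',D_2'',D_3,G_2,G_3$ of the canonical forms listed in the context. Their dimensions (as semi-algebraic sets) are $$\dim D_0=0,\quad \dim D_1=4,\quad \dim D_2=\dim D_2'=\dim D_2''=5,\quad \dim D_3=7,\quad \dim G_2=\dim G_3=8.$$
   Context: A tensor $\mathcal{T}\in\mathbb{R}^{2\times2\times2}$ has real entries $t_{ijk}$, $i,j,k\in\{1,2\}$. For real $2\times 2$ matrices $U,V,W$, the tensor $\mathcal{S}=\mathcal{T}\times_1U\times_2V\times_3W$ has entries $s_{\alpha\beta\gamma}=\sum_{i,j,k=1}^2 t_{ijk}u_{\alpha i}v_{\beta j}w_{\gamma k}$. $\mathrm{GL}(2)$ denotes the group of invertible real $2\times2$ matrices. Let $\mathcal{E}_{ijk}\in\mathbb{R}^{2\times2\times2}$ be the tensor with a $1$ in position $(i,j,k)$ and zeros elsewhere. The eight orbits are the orbits, under the action $(U,V,W)\cdot\mathcal{T}=\mathcal{T}\times_1U\times_2V\times_3W$ of $\mathrm{GL}(2)\times\mathrm{GL}(2)\times\mathrm{GL}(2)$ on $\mathbb{R}^{2\times2\times2}$, of the following canonical forms: - $D_0$: the zero tensor; - $D_1$: $\mathcal{E}_{111}$; - $D_2$: $\mathcal{E}_{111}+\mathcal{E}_{221}$;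 - $D_2'$: $\mathcal{E}_{111}+\mathcal{E}_{122}$; - $D_2''$: $\mathcal{E}_{111}+\mathcal{E}_{212}$; - $D_3$: $\mathcal{E}_{111}+\mathcal{E}_{122}+\mathcal{E}_{212}$; - $G_2$: $\mathcal{E}_{111}+\mathcal{E}_{222}$; - $G_3$: $\mathcal{E}_{111}+\mathcal{E}_{221}-\mathcal{E}_{122}+\mathcal{E}_{212}$. It is a previously known fact that these eight orbits are pairwise distinct and partition $\mathbb{R}^{2\times2\times2}$. Each orbit is a semi-algebraic subset of $\mathbb{R}^{2\times2\times2}\cong\mathbb{R}^8$. The dimension of a nonempty semi-algebraic set is its semi-algebraic dimension, i.e. the Krull dimension of its Zariski closure, equivalently the largest $d$ such that the set contains a subset semi-algebraically homeomorphic to the open cube $(0,1)^d$. *)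

theory Defs
  imports "HOL-Analysis.Analysis"
begin

text \<open>The entry \<open>t\<^sub>i\<^sub>j\<^sub>k\<close> of a tensor \<open>T\<close> is \<open>T $ i $ j $ k\<close>. The index type \<open>2\<close> has the
  two elements \<open>1\<close> and \<open>2\<close> (where \<open>2 = 0\<close>).\<close>

type_synonym tensor = "real ^ 2 ^ 2 ^ 2"

definition multilinear_mult ::
    "real ^ 2 ^ 2 \<Rightarrow> real ^ 2 ^ 2 \<Rightarrow> real ^ 2 ^ 2 \<Rightarrow> tensor \<Rightarrow> tensor" where
  "multilinear_mult U V W T =
     (\<chi> a b c. \<Sum>i\<in>UNIV. \<Sum>j\<in>UNIV. \<Sum>k\<in>UNIV.
        T $ i $ j $ k * U $ a $ i * V $ b $ j * W $ c $ k)"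

definition GL_orbit :: "tensor \<Rightarrow> tensor set" where
  "GL_orbit T = {multilinear_mult U V W T | U V W. invertible U \<and> invertible V \<and> invertible W}"

definition E :: "2 \<Rightarrow> 2 \<Rightarrow> 2 \<Rightarrow> tensor" where
  "E i j k = axis i (axis j (axis k 1))"

definition D0 :: "tensor set" where "D0 = GL_orbit 0"
definition D1 :: "tensor set" where "D1 = GL_orbit (E 1 1 1)"
definition D2 :: "tensor set" where "D2 = GL_orbit (E 1 1 1 + E 2 2 1)"
definition D2' :: "tensor set" where "D2' = GL_orbit (E 1 1 1 + E 1 2 2)"
definition D2'' :: "tensor set" where "D2'' = GL_orbit (E 1 1 1 + E 2 1 2)"
definition D3 :: "tensor set" where "D3 = GL_orbit (E 1 1 1 + E 1 2 2 + E 2 1 2)"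
definition G2 :: "tensor set" where "G2 = GL_orbit (E 1 1 1 + E 2 2 2)"
definition G3 :: "tensor set" where
  "G3 = GL_orbit (E 1 1 1 + E 2 2 1 - E 1 2 2 + E 2 1 2)"

text \<open>The Zariski topology on the real points of affine space, given by its basis of
  distinguished open sets \<open>{x. p x \<noteq> 0}\<close>; the closed sets are the common zero sets of
  families of real polynomials.\<close>

definition zariski :: "'a::euclidean_space topology" where
  "zariski = topology_generated_by {{x. p x \<noteq> 0} | p. real_polynomial_function p}"

definition irreducible_closedin :: "'a topology \<Rightarrow> 'a set \<Rightarrow> bool" where
  "irreducible_closedin X Z \<longleftrightarrow>
     closedin X Z \<and> Z \<noteq> {} \<and>
     (\<forall>A B. closedin X A \<and> closedin X B \<and> Z = A \<union> B \<longrightarrow> Z = A \<or> Z = B)"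

text \<open>The supremum of the lengths \<open>n\<close> of chains \<open>Z\<^sub>0 \<subset> Z\<^sub>1 \<subset> \<dots> \<subset> Z\<^sub>n\<close> of irreducible closed
  sets. The empty space gets the value \<open>0\<close>, so this is meant for nonempty spaces.\<close>

definition krull_dim :: "'a topology \<Rightarrow> enat" where
  "krull_dim X = Sup {enat n | n. \<exists>Z :: nat \<Rightarrow> 'a set.
     (\<forall>i\<le>n. irreducible_closedin X (Z i)) \<and> (\<forall>i<n. Z i \<subset> Z (Suc i))}"

text \<open>The dimension of a nonempty semi-algebraic set: the Krull dimension of its Zariski
  closure.\<close>

definition semialg_dim :: "'a::euclidean_space set \<Rightarrow> enat" where
  "semialg_dim S = krull_dim (subtopology zariski (zariski closure_of S))"

end

theory Submission
  imports Defs "HOL-Library.Function_Algebras"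
begin

text \<open>If \<open>Z\<^sub>0 \<subset> \<dots> \<subset> Z\<^sub>n\<close> are irreducible closed sets and \<open>p\<^sub>i\<close> vanishes on \<open>Z\<^sub>i\<close> but not on
  \<open>Z\<^sub>i\<^sub>+\<^sub>1\<close>, then the \<open>n\<close> functions \<open>p\<^sub>i\<close> are algebraically independent on \<open>Z\<^sub>n\<close>. If \<open>Z\<^sub>n\<close> lies in
  the closure of the image of a polynomial map \<open>\<phi>\<close> on \<open>\<real>\<^sup>d\<close>, the polynomials \<open>p\<^sub>i \<circ> \<phi>\<close> in \<open>d\<close>
  variables are still independent, and counting monomials gives \<open>n \<le> d\<close>. Conversely, the closures
  of the images of the coordinate subspaces of \<open>\<real>\<^sup>d\<close> are irreducible and form a chain of length \<open>d\<close>
  as soon as explicit polynomials separate them. Each orbit has such a dense parametrization.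

  The orbits are told apart by the vanishing of the tensor, the degeneracy of its three flattenings
  and the sign of Cayley's hyperdeterminant. A degenerate tensor is a matrix times a vector; every
  other tensor can be brought to the pencil spanned by the identity and the companion matrix of
  \<open>X\<^sup>2 - \<delta>\<close>, where only the sign of \<open>\<delta>\<close> matters.\<close>

subsection \<open>Polynomial functions\<close>

lemma real_polynomial_function_eq_0_if_infinite_zeros:
  fixes f :: "real \<Rightarrow> real"
  assumes "real_polynomial_function f" and "infinite {t. f t = 0}"
  shows "f x = 0"
proof -
  obtain a n where f: "f = (\<lambda>x. \<Sum>i\<le>n. a i * x ^ i)"
    using assms(1) real_polynomial_function_iff_sum by blast
  then have "\<forall>i\<le>n. a i = 0"
    using assms(2) polyfun_finite_roots[of a n] by auto
  then show ?thesis
    by (simp add: f)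
qed

lemma real_polynomial_function_on_line:
  assumes "real_polynomial_function p"
  shows "real_polynomial_function (\<lambda>t. p (x + t *\<^sub>R (y - x)))"
proof -
  have "polynomial_function (\<lambda>t::real. x + t *\<^sub>R (y - x))"
    by (intro polynomial_function_add polynomial_function_mult polynomial_function_const
        polynomial_function_id)
  from real_polynomial_function_compose[OF this assms] show ?thesis
    by (simp add: o_def)
qed

lemma real_polynomial_function_eq_0_if_open_zeros:
  fixes p :: "'a::real_normed_vector \<Rightarrow> real"
  assumes p: "real_polynomial_function p" and S: "open S" "S \<noteq> {}" "\<And>x. x \<in> S \<Longrightarrow> p x = 0"
  shows "p y = 0"
proof -
  obtain x where x: "x \<in> S"
    using S by auto
  let ?l = "\<lambda>t::real. x + t *\<^sub>R (y - x)"
  have "open (?l -` S)"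
    by (intro open_vimage S continuous_intros)
  moreover have "0 \<in> ?l -` S"
    using x by simp
  ultimately have "infinite (?l -` S)"
    using infinite_openin[of UNIV "?l -` S" 0] by simp
  then have "infinite {t. p (?l t) = 0}"
    by (rule contrapos_nn) (auto elim!: rev_finite_subset simp: S(3))
  from real_polynomial_function_eq_0_if_infinite_zeros
      [OF real_polynomial_function_on_line[OF p] this, of 1]
  show ?thesis
    by simp
qed

lemma real_polynomial_function_mult_eq_0_on_convex:
  assumes p: "real_polynomial_function p" and q: "real_polynomial_function q"
    and S: "convex S" and pq: "\<And>x. x \<in> S \<Longrightarrow> p x * q x = 0"
  shows "(\<forall>x\<in>S. p x = 0) \<or> (\<forall>x\<in>S. q x = 0)"
proof (rule ccontr)
  assume "\<not> ?thesis"
  then obtain x y where xy: "x \<in> S" "y \<in> S" "p x \<noteq> 0" "q y \<noteq> 0"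
    by blast
  let ?l = "\<lambda>t::real. x + t *\<^sub>R (y - x)"
  have "?l t \<in> S" if "t \<in> {0..1}" for t
    using convexD_alt[OF S xy(1,2), of t] that by (simp add: algebra_simps)
  then have "p (?l t) = 0 \<or> q (?l t) = 0" if "t \<in> {0..1}" for t
    using pq[of "?l t"] that by simp
  then have "{0..1} \<subseteq> {t. p (?l t) = 0} \<union> {t. q (?l t) = 0}"
    by blast
  moreover have "infinite {0..1::real}"
    by (simp add: infinite_Icc)
  ultimately have "infinite {t. p (?l t) = 0} \<or> infinite {t. q (?l t) = 0}"
    by (metis finite_Un finite_subset)
  then show False
    using real_polynomial_function_eq_0_if_infinite_zeros
        [OF real_polynomial_function_on_line[OF p], of x y 0]
      real_polynomial_function_eq_0_if_infinite_zeros
        [OF real_polynomial_function_on_line[OF q], of x y 1] xy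
    by auto
qed

subsection \<open>The Zariski topology\<close>

lemma openin_zariski_nonzero:
  "real_polynomial_function p \<Longrightarrow> openin zariski {x. p x \<noteq> 0}"
  unfolding zariski_def by (intro topology_generated_by_Basis) auto

lemma topspace_zariski [simp]: "topspace zariski = UNIV"
proof -
  have "openin zariski {x. (1::real) \<noteq> 0}"
    by (intro openin_zariski_nonzero real_polynomial_function.intros(2))
  then show ?thesis
    using openin_subset by fastforce
qed

lemma openin_zariski_basis:
  assumes "openin zariski U" and "x \<in> U"
  shows "\<exists>p. real_polynomial_function p \<and> p x \<noteq> 0 \<and> (\<forall>y. p y \<noteq> 0 \<longrightarrow> y \<in> U)"
proof -
  have "generate_topology_on {{x. p x \<noteq> 0} | p. real_polynomial_function p} U"
    using assms(1) by (simp add: zariski_def openin_topology_generated_by_iff)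
  then show ?thesis
    using assms(2)
  proof induction
    case (Int a b)
    then obtain p q where pq: "real_polynomial_function p" "p x \<noteq> 0" "\<forall>y. p y \<noteq> 0 \<longrightarrow> y \<in> a"
        "real_polynomial_function q" "q x \<noteq> 0" "\<forall>y. q y \<noteq> 0 \<longrightarrow> y \<in> b"
      by auto
    then show ?case
      by (intro exI[of _ "\<lambda>x. p x * q x"]) auto
  next
    case (UN K)
    then show ?case
      by (meson UnionE UnionI)
  qed auto
qed

lemma closedin_zariski_zeros:
  assumes "real_polynomial_function p"
  shows "closedin zariski {x. p x = 0}"
proof -
  have "UNIV - {x. p x = 0} = {x. p x \<noteq> 0}"
    by auto
  then show ?thesis
    using openin_zariski_nonzero[OF assms] by (simp add: closedin_def)
qed

lemma closedin_zariski_separate: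
  assumes "closedin zariski Z" and "x \<notin> Z"
  obtains p where "real_polynomial_function p" "p x \<noteq> 0" "\<And>z. z \<in> Z \<Longrightarrow> p z = 0"
proof -
  have "openin zariski (- Z)"
    using assms(1) by (simp add: closedin_def Compl_eq_Diff_UNIV)
  from openin_zariski_basis[OF this, of x] show ?thesis
    using assms(2) that by auto
qed

lemma zariski_closure_subset_zeros:
  assumes "real_polynomial_function p" and "\<And>s. s \<in> S \<Longrightarrow> p s = 0"
    and "x \<in> zariski closure_of S"
  shows "p x = 0"
  using closure_of_minimal[OF _ closedin_zariski_zeros[OF assms(1)], of S] assms by auto

lemma in_zariski_closure_iff:
  "x \<in> zariski closure_of S \<longleftrightarrow>
     (\<forall>p. real_polynomial_function p \<longrightarrow> (\<forall>s\<in>S. p s = 0) \<longrightarrow> p x = 0)"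
proof
  assume *: "\<forall>p. real_polynomial_function p \<longrightarrow> (\<forall>s\<in>S. p s = 0) \<longrightarrow> p x = 0"
  show "x \<in> zariski closure_of S"
  proof (rule ccontr)
    assume "x \<notin> zariski closure_of S"
    then obtain p where "real_polynomial_function p" "p x \<noteq> 0"
        "\<And>z. z \<in> zariski closure_of S \<Longrightarrow> p z = 0"
      using closedin_zariski_separate[OF closedin_closure_of] by blast
    then show False
      using * closure_of_subset[of S zariski] by auto
  qed
qed (use zariski_closure_subset_zeros in blast)

lemma polynomial_image_subset_zariski_closure:
  assumes f: "polynomial_function f" and "open U" "U \<noteq> {}"
    and U: "\<And>x. x \<in> U \<Longrightarrow> f x \<in> zariski closure_of S"
  shows "range f \<subseteq> zariski closure_of S"
proof safe
  fix y
  show "f y \<in> zariski closure_of S"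
    unfolding in_zariski_closure_iff
  proof (intro allI impI)
    fix p assume p: "real_polynomial_function p" and "\<forall>s\<in>S. p s = 0"
    then have "(p \<circ> f) x = 0" if "x \<in> U" for x
      using U[OF that] by (auto simp: in_zariski_closure_iff)
    from real_polynomial_function_eq_0_if_open_zeros
        [OF real_polynomial_function_compose[OF f p] assms(2,3) this]
    show "p (f y) = 0"
      by simp
  qed
qed

lemma irreducible_closedin_zariski_closure_image:
  assumes f: "polynomial_function f" and C: "convex C" "C \<noteq> {}"
  shows "irreducible_closedin zariski (zariski closure_of (f ` C))"
  unfolding irreducible_closedin_def
proof (intro conjI allI impI)
  have sub: "f ` C \<subseteq> zariski closure_of (f ` C)"
    by (simp add: closure_of_subset)
  then show "zariski closure_of (f ` C) \<noteq> {}"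
    using C(2) by auto
  fix A B
  assume AB: "closedin zariski A \<and> closedin zariski B \<and> zariski closure_of (f ` C) = A \<union> B"
  have "f ` C \<subseteq> A \<or> f ` C \<subseteq> B"
  proof (rule ccontr)
    assume "\<not> ?thesis"
    then obtain x y where xy: "x \<in> C" "f x \<notin> A" "y \<in> C" "f y \<notin> B"
      by auto
    obtain p where p: "real_polynomial_function p" "p (f x) \<noteq> 0" "\<And>z. z \<in> A \<Longrightarrow> p z = 0"
      using closedin_zariski_separate AB xy(2) by blast
    obtain q where q: "real_polynomial_function q" "q (f y) \<noteq> 0" "\<And>z. z \<in> B \<Longrightarrow> q z = 0"
      using closedin_zariski_separate AB xy(4) by blast
    have "(p \<circ> f) z * (q \<circ> f) z = 0" if "z \<in> C" for z
    proof -
      have "f z \<in> A \<union> B"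
        using that sub AB by auto
      then show ?thesis
        using p(3) q(3) by auto
    qed
    from real_polynomial_function_mult_eq_0_on_convex
        [OF real_polynomial_function_compose[OF f p(1)]
          real_polynomial_function_compose[OF f q(1)] C(1) this]
    show False
      using xy p(2) q(2) by auto
  qed
  then show "zariski closure_of (f ` C) = A \<or> zariski closure_of (f ` C) = B"
    using AB closure_of_minimal by blast
qed simp

lemma irreducible_closedin_zariski_mult_eq_0:
  assumes Z: "irreducible_closedin zariski Z"
    and p: "real_polynomial_function p" and q: "real_polynomial_function q"
    and pq: "\<And>x. x \<in> Z \<Longrightarrow> p x * q x = 0"
  shows "(\<forall>x\<in>Z. p x = 0) \<or> (\<forall>x\<in>Z. q x = 0)"
proof -
  have "closedin zariski (Z \<inter> {x. p x = 0})" "closedin zariski (Z \<inter> {x. q x = 0})"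
    using Z closedin_zariski_zeros[OF p] closedin_zariski_zeros[OF q]
    by (auto simp: irreducible_closedin_def)
  moreover have "Z = (Z \<inter> {x. p x = 0}) \<union> (Z \<inter> {x. q x = 0})"
    using pq by auto
  ultimately have "Z = Z \<inter> {x. p x = 0} \<or> Z = Z \<inter> {x. q x = 0}"
    using Z unfolding irreducible_closedin_def by blast
  then show ?thesis
    by blast
qed

lemma irreducible_closedin_subtopology:
  assumes "closedin X V"
  shows "irreducible_closedin (subtopology X V) Z \<longleftrightarrow> irreducible_closedin X Z \<and> Z \<subseteq> V"
  unfolding irreducible_closedin_def closedin_closed_subtopology[OF assms] by blast

subsection \<open>Algebraic dependence of many polynomials in few variables\<close>

interpretation fun_space: vector_space "\<lambda>(c::real) f x. c * f x :: real"
  by unfold_locales (auto simp: fun_eq_iff algebra_simps)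

lemma sum_fun_apply: "(\<Sum>i\<in>I. f i) x = (\<Sum>i\<in>I. f i x)"
  for f :: "'i \<Rightarrow> 'a \<Rightarrow> 'b::comm_monoid_add"
  by (induction I rule: infinite_finite_induct) auto

lemma linear_relation_in_span:
  fixes g :: "'i \<Rightarrow> 'a \<Rightarrow> real"
  assumes "finite I" "finite F" "card F < card I" and g: "\<And>i. i \<in> I \<Longrightarrow> g i \<in> fun_space.span F"
  shows "\<exists>c. (\<exists>i\<in>I. c i \<noteq> 0) \<and> (\<forall>x. (\<Sum>i\<in>I. c i * g i x) = 0)"
proof (cases "inj_on g I")
  case True
  have "\<not> fun_space.independent (g ` I)"
    using fun_space.independent_span_bound[of F "g ` I"] assms
    by (auto simp: card_image[OF True])
  then obtain u where u: "\<exists>v\<in>g ` I. u v \<noteq> 0" "(\<Sum>v\<in>g ` I. (\<lambda>x. u v * v x)) = 0"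
    using assms(1) by (auto simp: fun_space.dependent_finite)
  have "(\<Sum>i\<in>I. u (g i) * g i x) = 0" for x
    using fun_cong[OF u(2), of x] by (simp add: sum_fun_apply sum.reindex[OF True])
  then show ?thesis
    using u(1) by (intro exI[of _ "u \<circ> g"]) auto
next
  case False
  then obtain i j where ij: "i \<in> I" "j \<in> I" "i \<noteq> j" "g i = g j"
    by (auto simp: inj_on_def)
  let ?c = "\<lambda>k. if k = i then 1 else if k = j then - 1 else (0::real)"
  have "(\<Sum>k\<in>I. ?c k * g k x) = 0" for x
  proof -
    have "(\<Sum>k\<in>I. ?c k * g k x) = (\<Sum>k\<in>{i, j}. ?c k * g k x)"
      using ij assms(1) by (intro sum.mono_neutral_right) auto
    then show ?thesis
      using ij by simp
  qed
  then show ?thesis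
    using ij by (intro exI[of _ ?c]) auto
qed

definition monomials :: "nat \<Rightarrow> ('a::euclidean_space \<Rightarrow> real) set" where
  "monomials k = (\<lambda>a x. \<Prod>b\<in>Basis. (x \<bullet> b) ^ a b) ` (Basis \<rightarrow>\<^sub>E {..k})"

lemma finite_monomials [simp]: "finite (monomials k)"
  by (simp add: monomials_def finite_PiE)

lemma card_monomials_le: "card (monomials k :: ('a::euclidean_space \<Rightarrow> real) set) \<le> (k + 1) ^ DIM('a)"
proof -
  have "card (monomials k :: ('a \<Rightarrow> real) set) \<le> card ((Basis :: 'a set) \<rightarrow>\<^sub>E {..k})"
    unfolding monomials_def by (intro card_image_le finite_PiE) auto
  then show ?thesis
    by (simp add: card_PiE)
qed

lemma monomial_mem:
  assumes "\<And>b. b \<in> Basis \<Longrightarrow> a b \<le> k"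
  shows "(\<lambda>x::'a::euclidean_space. \<Prod>b\<in>Basis. (x \<bullet> b) ^ a b) \<in> monomials k"
proof -
  have "(\<lambda>x::'a. \<Prod>b\<in>Basis. (x \<bullet> b) ^ a b) = (\<lambda>x. \<Prod>b\<in>Basis. (x \<bullet> b) ^ restrict a Basis b)"
    by (auto simp: fun_eq_iff intro!: prod.cong)
  then show ?thesis
    unfolding monomials_def using assms by (intro image_eqI[of _ _ "restrict a Basis"]) auto
qed

lemma monomials_mono: "k \<le> l \<Longrightarrow> monomials k \<subseteq> monomials l"
  by (force simp: monomials_def PiE_iff)

lemma monomials_mult:
  assumes "f \<in> monomials k" "g \<in> monomials l"
  shows "(\<lambda>x. f x * g x) \<in> monomials (k + l)"
proof -
  obtain a b where "f = (\<lambda>x. \<Prod>c\<in>Basis. (x \<bullet> c) ^ a c)" "a \<in> Basis \<rightarrow>\<^sub>E {..k}"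
     "g = (\<lambda>x. \<Prod>c\<in>Basis. (x \<bullet> c) ^ b c)" "b \<in> Basis \<rightarrow>\<^sub>E {..l}"
    using assms by (auto simp: monomials_def)
  then show ?thesis
    using monomial_mem[of "\<lambda>c. a c + b c" "k + l"]
    by (auto simp: PiE_iff power_add prod.distrib add_mono)
qed

lemma fun_space_span_mult:
  assumes "f \<in> fun_space.span A" "g \<in> fun_space.span B"
    and AB: "\<And>u v. u \<in> A \<Longrightarrow> v \<in> B \<Longrightarrow> (\<lambda>x. u x * v x) \<in> fun_space.span C"
  shows "(\<lambda>x. f x * g x) \<in> fun_space.span C"
proof -
  have *: "(\<lambda>x. u x * g x) \<in> fun_space.span C" if "u \<in> A" for u
    using assms(2)
  proof (induction rule: fun_space.span_induct_alt)
    case base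
    then show ?case
      using fun_space.span_zero[of C] by (simp add: zero_fun_def)
  next
    case (step c v w)
    have "(\<lambda>x. u x * ((\<lambda>x. c * v x) + w) x) = (\<lambda>x. c * (u x * v x)) + (\<lambda>x. u x * w x)"
      by (auto simp: fun_eq_iff algebra_simps)
    moreover have "\<dots> \<in> fun_space.span C"
      using fun_space.span_add[OF fun_space.span_scale[OF AB[OF that step(1)], of c] step(2)] .
    ultimately show ?case
      by simp
  qed
  show ?thesis
    using assms(1)
  proof (induction rule: fun_space.span_induct_alt)
    case base
    then show ?case
      using fun_space.span_zero[of C] by (simp add: zero_fun_def)
  next
    case (step c v w)
    have "(\<lambda>x. ((\<lambda>x. c * v x) + w) x * g x) = (\<lambda>x. c * (v x * g x)) + (\<lambda>x. w x * g x)"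
      by (auto simp: fun_eq_iff algebra_simps)
    moreover have "\<dots> \<in> fun_space.span C"
      using fun_space.span_add[OF fun_space.span_scale[OF *[OF step(1)], of c] step(2)] .
    ultimately show ?case
      by simp
  qed
qed

lemma span_monomials_mult:
  assumes "f \<in> fun_space.span (monomials k)" "g \<in> fun_space.span (monomials l)"
  shows "(\<lambda>x. f x * g x) \<in> fun_space.span (monomials (k + l))"
  using assms(1,2) by (rule fun_space_span_mult) (intro fun_space.span_base monomials_mult)

lemma span_monomials_mono:
  assumes "f \<in> fun_space.span (monomials k)" "k \<le> l"
  shows "f \<in> fun_space.span (monomials l)"
  using fun_space.span_mono[OF monomials_mono[OF assms(2)]] assms(1) by blast

lemma const_in_span_monomials: "(\<lambda>x::'a::euclidean_space. c) \<in> fun_space.span (monomials k)"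
proof -
  have "(\<lambda>x::'a. 1) \<in> monomials k"
    using monomial_mem[of "\<lambda>_. 0" k] by simp
  from fun_space.span_scale[OF fun_space.span_base[OF this], of c] show ?thesis
    by simp
qed

lemma real_polynomial_function_in_span_monomials:
  fixes f :: "'a::euclidean_space \<Rightarrow> real"
  assumes "real_polynomial_function f"
  shows "\<exists>k. f \<in> fun_space.span (monomials k)"
  using assms
proof induction
  case (linear f)
  have "(\<lambda>x::'a. x \<bullet> b) \<in> monomials 1" if "b \<in> Basis" for b
    using monomial_mem[of "\<lambda>c. if c = b then 1 else 0" 1] that
    by (simp add: if_distrib[of "\<lambda>n. _ ^ n"] cong: if_cong)
  then have "(\<Sum>b\<in>Basis. (\<lambda>x. f b * (x \<bullet> b))) \<in> fun_space.span (monomials 1)"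
    by (intro fun_space.span_sum fun_space.span_scale fun_space.span_base)
  moreover have "(\<Sum>b\<in>Basis. (\<lambda>x. f b * (x \<bullet> b))) = f"
  proof
    fix x
    interpret bounded_linear f by fact
    have "f x = f (\<Sum>b\<in>Basis. (x \<bullet> b) *\<^sub>R b)"
      by (simp add: euclidean_representation)
    then show "(\<Sum>b\<in>Basis. (\<lambda>x. f b * (x \<bullet> b))) x = f x"
      by (simp add: sum_fun_apply sum scale mult.commute)
  qed
  ultimately show ?case
    by auto
next
  case (const c)
  then show ?case
    using const_in_span_monomials by blast
next
  case (add f g)
  then obtain k l where "f \<in> fun_space.span (monomials k)" "g \<in> fun_space.span (monomials l)"
    by blast
  then have "f + g \<in> fun_space.span (monomials (k + l))"
    by (intro fun_space.span_add) (auto elim: span_monomials_mono)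
  then show ?case
    by (auto simp: plus_fun_def)
next
  case (mult f g)
  then show ?case
    using span_monomials_mult by blast
qed

lemma span_monomials_power:
  assumes "f \<in> fun_space.span (monomials k)"
  shows "(\<lambda>x. f x ^ e) \<in> fun_space.span (monomials (e * k))"
proof (induction e)
  case 0
  then show ?case
    using const_in_span_monomials[of 1] by simp
next
  case (Suc e)
  then show ?case
    using span_monomials_mult[OF assms] by simp
qed

lemma span_monomials_prod:
  assumes "\<And>i. i < n \<Longrightarrow> f i \<in> fun_space.span (monomials k)"
  shows "(\<lambda>x. \<Prod>i<n. f i x) \<in> fun_space.span (monomials (n * k))"
  using assms
proof (induction n)
  case 0
  then show ?case
    using const_in_span_monomials[of 1] by simp
next
  case (Suc n)
  then have "(\<lambda>x. (\<Prod>i<n. f i x) * f n x) \<in> fun_space.span (monomials (n * k + k))"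
    by (intro span_monomials_mult) auto
  then show ?case
    by (simp add: add.commute)
qed

lemma algebraic_relation_of_many_polynomials:
  fixes q :: "nat \<Rightarrow> 'a::euclidean_space \<Rightarrow> real"
  assumes q: "\<forall>i<n. real_polynomial_function (q i)" and n: "DIM('a) < n"
  shows "\<exists>m c. (\<exists>e\<in>{..<n} \<rightarrow>\<^sub>E {..m}. c e \<noteq> 0) \<and>
    (\<forall>x. (\<Sum>e\<in>{..<n} \<rightarrow>\<^sub>E {..m}. c e * (\<Prod>i<n. q i x ^ e i)) = 0)"
proof -
  have "\<forall>i\<in>{..<n}. \<exists>k. q i \<in> fun_space.span (monomials k)"
    using q real_polynomial_function_in_span_monomials by blast
  then obtain k where k: "\<And>i. i < n \<Longrightarrow> q i \<in> fun_space.span (monomials (k i))"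
    using bchoice[of "{..<n}" "\<lambda>i k. q i \<in> fun_space.span (monomials k)"] by auto
  define K where "K = (\<Sum>i<n. k i)"
  have K: "q i \<in> fun_space.span (monomials K)" if "i < n" for i
    using k[OF that] by (rule span_monomials_mono) (use that in \<open>simp add: K_def member_le_sum\<close>)
  define m where "m = (n * K + 1) ^ DIM('a)"
  let ?E = "{..<n} \<rightarrow>\<^sub>E {..m}"
  have mem: "(\<lambda>x. \<Prod>i<n. q i x ^ e i) \<in> fun_space.span (monomials (n * (m * K)))"
    if "e \<in> ?E" for e
  proof (rule span_monomials_prod)
    fix i assume i: "i < n"
    have "e i * K \<le> m * K"
      using that i by (intro mult_right_mono) auto
    then show "(\<lambda>x. q i x ^ e i) \<in> fun_space.span (monomials (m * K))"
      using span_monomials_power[OF K[OF i]] span_monomials_mono by blast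
  qed
  have "card (monomials (n * (m * K)) :: ('a \<Rightarrow> real) set) \<le> (n * (m * K) + 1) ^ DIM('a)"
    by (rule card_monomials_le)
  also have "\<dots> \<le> ((n * K + 1) * (m + 1)) ^ DIM('a)"
    by (intro power_mono) (auto simp: algebra_simps)
  also have "\<dots> = m * (m + 1) ^ DIM('a)"
    unfolding power_mult_distrib m_def ..
  also have "\<dots> < (m + 1) * (m + 1) ^ DIM('a)"
    by simp
  also have "\<dots> = (m + 1) ^ Suc (DIM('a))"
    by simp
  also have "\<dots> \<le> (m + 1) ^ n"
    using n by (intro power_increasing) auto
  also have "\<dots> = card ?E"
    by (simp add: card_PiE)
  finally have "card (monomials (n * (m * K)) :: ('a \<Rightarrow> real) set) < card ?E" .
  then show ?thesis
    using linear_relation_in_span[of ?E "monomials (n * (m * K))" "\<lambda>e x. \<Prod>i<n. q i x ^ e i"]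
      mem by (auto simp: finite_PiE)
qed

subsection \<open>Krull dimension of closures of polynomial images\<close>

lemma sum_PiE_lessThan_Suc:
  "(\<Sum>e\<in>{..<Suc n} \<rightarrow>\<^sub>E A. f e) = (\<Sum>y\<in>A. \<Sum>g\<in>{..<n} \<rightarrow>\<^sub>E A. f (g(n := y)))"
proof -
  have "(\<Sum>e\<in>{..<Suc n} \<rightarrow>\<^sub>E A. f e) = (\<Sum>(y, g)\<in>A \<times> ({..<n} \<rightarrow>\<^sub>E A). f (g(n := y)))"
    unfolding lessThan_Suc PiE_insert_eq
    by (subst sum.reindex[OF inj_combinator]) (auto simp: case_prod_unfold)
  then show ?thesis
    by (simp add: sum.cartesian_product)
qed

text \<open>On \<open>Z (Suc n)\<close> the lowest power of \<open>p n\<close> in a relation can be cancelled, and restricting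
  what is left to \<open>Z n\<close>, where \<open>p n\<close> vanishes, gives a relation between \<open>p 0, \<dots>, p (n - 1)\<close>.\<close>

lemma irreducible_chain_algebraically_independent:
  assumes Z: "\<And>i. i \<le> n \<Longrightarrow> irreducible_closedin zariski (Z i)"
    and sub: "\<And>i. i < n \<Longrightarrow> Z i \<subseteq> Z (Suc i)"
    and p: "\<And>i. i < n \<Longrightarrow> real_polynomial_function (p i)"
    and p0: "\<And>i z. i < n \<Longrightarrow> z \<in> Z i \<Longrightarrow> p i z = 0"
    and p1: "\<And>i. i < n \<Longrightarrow> \<exists>z\<in>Z (Suc i). p i z \<noteq> 0"
    and rel: "\<And>x. x \<in> Z n \<Longrightarrow> (\<Sum>e\<in>{..<n} \<rightarrow>\<^sub>E {..m}. c e * (\<Prod>i<n. p i x ^ e i)) = 0"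
    and e: "e \<in> {..<n} \<rightarrow>\<^sub>E {..m}"
  shows "c e = 0"
  using assms
proof (induction n arbitrary: c e)
  case 0
  then obtain z where "z \<in> Z 0"
    by (auto simp: irreducible_closedin_def)
  then show ?case
    using 0 by auto
next
  case (Suc n)
  let ?E = "{..<n} \<rightarrow>\<^sub>E {..m}"
  define R where "R y x = (\<Sum>g\<in>?E. c (g(n := y)) * (\<Prod>i<n. p i x ^ g i))" for y x
  have R: "real_polynomial_function (R y)" for y
    unfolding R_def using Suc.prems(3)
    by (intro real_polynomial_function_sum real_polynomial_function_prod
        real_polynomial_function_power real_polynomial_function.intros(4)
        real_polynomial_function.intros(2) finite_PiE) auto
  have rel': "(\<Sum>y\<le>m. p n x ^ y * R y x) = 0" if "x \<in> Z (Suc n)" for x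
  proof -
    have "(\<Prod>i<Suc n. p i x ^ (g(n := y)) i) = p n x ^ y * (\<Prod>i<n. p i x ^ g i)" for g y
      by (simp add: mult.commute)
    then show ?thesis
      using Suc.prems(6)[OF that] unfolding sum_PiE_lessThan_Suc R_def
      by (simp add: sum_distrib_left mult_ac del: prod.lessThan_Suc)
  qed
  have pn: "\<exists>z\<in>Z (Suc n). p n z ^ y \<noteq> 0" for y
    using Suc.prems(5)[of n] by auto
  have zero: "\<forall>g\<in>?E. c (g(n := y)) = 0" if "y \<le> m" for y
    using that
  proof (induction y rule: less_induct)
    case (less y)
    have R0: "R y' x = 0" if "y' < y" for y' x
      unfolding R_def using less.IH[OF that] less.prems that
      by (intro sum.neutral) (auto simp del: fun_upd_apply)
    define Q where "Q x = (\<Sum>y'\<in>{y..m}. p n x ^ (y' - y) * R y' x)" for x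
    have Q: "real_polynomial_function Q"
      unfolding Q_def using Suc.prems(3)[of n] R
      by (intro real_polynomial_function_sum real_polynomial_function.intros(4)
          real_polynomial_function_power) auto
    have "p n x ^ y * Q x = 0" if "x \<in> Z (Suc n)" for x
    proof -
      have "p n x ^ y * Q x = (\<Sum>y'\<in>{y..m}. p n x ^ y' * R y' x)"
        unfolding Q_def sum_distrib_left
        by (intro sum.cong) (auto simp: mult.assoc[symmetric] power_add[symmetric])
      also have "\<dots> = (\<Sum>y'\<le>m. p n x ^ y' * R y' x)"
        by (intro sum.mono_neutral_left) (auto simp: R0)
      finally show ?thesis
        using rel'[OF that] by simp
    qed
    then have "\<forall>x\<in>Z (Suc n). Q x = 0"
      using irreducible_closedin_zariski_mult_eq_0
          [OF Suc.prems(1)[of "Suc n"] real_polynomial_function_power[OF Suc.prems(3)[of n]] Q]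
        pn by blast
    moreover have "Q x = R y x" if "x \<in> Z n" for x
    proof -
      have "Q x = (\<Sum>y'\<in>{y}. p n x ^ (y' - y) * R y' x)"
        unfolding Q_def using less.prems Suc.prems(4)[OF _ that]
        by (intro sum.mono_neutral_right) auto
      then show ?thesis
        by simp
    qed
    ultimately have Ry: "R y x = 0" if "x \<in> Z n" for x
      using Suc.prems(2)[of n] that by (metis lessI subsetD)
    show ?case
    proof
      fix g assume "g \<in> ?E"
      show "c (g(n := y)) = 0"
      proof (rule Suc.IH[of "\<lambda>g. c (g(n := y))"])
        show "(\<Sum>g\<in>?E. c (g(n := y)) * (\<Prod>i<n. p i x ^ g i)) = 0" if "x \<in> Z n" for x
          using Ry[OF that] by (simp add: R_def)
        show "g \<in> ?E"
          by fact
      qed (simp_all only: Suc.prems(1-5) less_SucI le_SucI)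
    qed
  qed
  have "restrict e {..<n} \<in> ?E" and "e n \<le> m" and "e = (restrict e {..<n})(n := e n)"
    using Suc.prems(7) by (auto simp: PiE_iff extensional_def fun_eq_iff less_Suc_eq)
  then show ?case
    using zero[of "e n"] by metis
qed

lemma irreducible_chain_length_le:
  fixes \<phi> :: "'a::euclidean_space \<Rightarrow> 'b::euclidean_space"
  assumes \<phi>: "polynomial_function \<phi>"
    and Z: "\<And>i. i \<le> n \<Longrightarrow> irreducible_closedin zariski (Z i)"
    and lt: "\<And>i. i < n \<Longrightarrow> Z i \<subset> Z (Suc i)"
    and top: "Z n \<subseteq> zariski closure_of (range \<phi>)"
  shows "n \<le> DIM('a)"
proof (rule ccontr)
  assume n: "\<not> n \<le> DIM('a)"
  have "\<forall>i\<in>{..<n}. \<exists>p. real_polynomial_function p \<and> (\<forall>z\<in>Z i. p z = 0) \<and> (\<exists>z\<in>Z (Suc i). p z \<noteq> 0)"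
  proof
    fix i assume "i \<in> {..<n}"
    then obtain z where z: "z \<in> Z (Suc i)" "z \<notin> Z i" and "closedin zariski (Z i)"
      using lt[of i] Z[of i] by (auto simp: irreducible_closedin_def)
    then show "\<exists>p. real_polynomial_function p \<and> (\<forall>z\<in>Z i. p z = 0) \<and> (\<exists>z\<in>Z (Suc i). p z \<noteq> 0)"
      using closedin_zariski_separate by metis
  qed
  from bchoice[OF this] obtain p where "\<forall>i\<in>{..<n}. real_polynomial_function (p i) \<and>
      (\<forall>z\<in>Z i. p i z = 0) \<and> (\<exists>z\<in>Z (Suc i). p i z \<noteq> 0)" ..
  then have p: "\<And>i. i < n \<Longrightarrow> real_polynomial_function (p i)"
      "\<And>i z. i < n \<Longrightarrow> z \<in> Z i \<Longrightarrow> p i z = 0" "\<And>i. i < n \<Longrightarrow> \<exists>z\<in>Z (Suc i). p i z \<noteq> 0"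
    by auto
  have "\<forall>i<n. real_polynomial_function (p i \<circ> \<phi>)" and "DIM('a) < n"
    using real_polynomial_function_compose[OF \<phi> p(1)] n by simp_all
  from algebraic_relation_of_many_polynomials[OF this] obtain m c
    where c: "\<exists>e\<in>{..<n} \<rightarrow>\<^sub>E {..m}. c e \<noteq> 0"
      "\<And>x. (\<Sum>e\<in>{..<n} \<rightarrow>\<^sub>E {..m}. c e * (\<Prod>i<n. (p i \<circ> \<phi>) x ^ e i)) = 0"
    by blast
  let ?P = "\<lambda>x. \<Sum>e\<in>{..<n} \<rightarrow>\<^sub>E {..m}. c e * (\<Prod>i<n. p i x ^ e i)"
  have "real_polynomial_function ?P"
    using p(1) by (intro real_polynomial_function_sum real_polynomial_function_prod
        real_polynomial_function_power real_polynomial_function.intros(4)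
        real_polynomial_function.intros(2) finite_PiE) auto
  then have P: "?P x = 0" if "x \<in> Z n" for x
    by (rule zariski_closure_subset_zeros[where S = "range \<phi>"]) (use c(2) top that in auto)
  have "c e = 0" if "e \<in> {..<n} \<rightarrow>\<^sub>E {..m}" for e
  proof (rule irreducible_chain_algebraically_independent[where Z = Z and p = p and c = c and e = e])
    show "Z i \<subseteq> Z (Suc i)" if "i < n" for i
      using lt[OF that] by blast
  qed (fact Z p P that)+
  then show False
    using c(1) by blast
qed

lemma semialg_dim_eqI:
  fixes \<phi> :: "'a::euclidean_space \<Rightarrow> 'b::euclidean_space"
  assumes \<phi>: "polynomial_function \<phi>"
    and cl: "S \<subseteq> zariski closure_of (range \<phi>)" "range \<phi> \<subseteq> zariski closure_of S"
    and C: "\<And>k. convex (C k)" "\<And>k. C k \<noteq> {}" "\<And>k. C k \<subseteq> C (Suc k)"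
    and f: "\<And>k. k < DIM('a) \<Longrightarrow> real_polynomial_function (f k)"
      "\<And>k x. k < DIM('a) \<Longrightarrow> x \<in> C k \<Longrightarrow> f k (\<phi> x) = 0"
      "\<And>k. k < DIM('a) \<Longrightarrow> \<exists>x\<in>C (Suc k). f k (\<phi> x) \<noteq> 0"
  shows "semialg_dim S = enat (DIM('a))"
proof -
  define V where "V = zariski closure_of S"
  have V: "closedin zariski V" "V = zariski closure_of (range \<phi>)"
    using cl by (auto simp: V_def closure_of_minimal subset_antisym)
  define Z where "Z k = zariski closure_of (\<phi> ` C k)" for k
  have irr: "irreducible_closedin zariski (Z k)" for k
    unfolding Z_def by (intro irreducible_closedin_zariski_closure_image \<phi> C)
  have ZV: "Z k \<subseteq> V" for k
    unfolding Z_def V by (intro closure_of_mono) auto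
  have lt: "Z k \<subset> Z (Suc k)" if k: "k < DIM('a)" for k
  proof -
    obtain x where x: "x \<in> C (Suc k)" "f k (\<phi> x) \<noteq> 0"
      using f(3)[OF k] by blast
    have "\<phi> x \<notin> Z k"
      using zariski_closure_subset_zeros[OF f(1)[OF k], of "\<phi> ` C k" "\<phi> x"] f(2)[OF k] x(2)
      by (auto simp: Z_def)
    moreover have "\<phi> x \<in> Z (Suc k)"
      unfolding Z_def using x(1) closure_of_subset[of "\<phi> ` C (Suc k)" zariski] by auto
    moreover have "Z k \<subseteq> Z (Suc k)"
      unfolding Z_def by (intro closure_of_mono image_mono C)
    ultimately show ?thesis
      by blast
  qed
  have "krull_dim (subtopology zariski V) = enat (DIM('a))"
    unfolding krull_dim_def irreducible_closedin_subtopology[OF V(1)]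
  proof (rule antisym)
    show "enat (DIM('a)) \<le> Sup {enat n | n. \<exists>Z. (\<forall>i\<le>n. irreducible_closedin zariski (Z i) \<and> Z i \<subseteq> V) \<and>
        (\<forall>i<n. Z i \<subset> Z (Suc i))}"
      using irr ZV lt by (intro Sup_upper) blast
    show "Sup {enat n | n. \<exists>Z. (\<forall>i\<le>n. irreducible_closedin zariski (Z i) \<and> Z i \<subseteq> V) \<and>
        (\<forall>i<n. Z i \<subset> Z (Suc i))} \<le> enat (DIM('a))"
    proof (rule Sup_least, safe)
      fix n :: nat and Z
      assume "\<forall>i\<le>n. irreducible_closedin zariski (Z i) \<and> Z i \<subseteq> V" "\<forall>i<n. Z i \<subset> Z (Suc i)"
      then have "n \<le> DIM('a)"
        using V(2) by (intro irreducible_chain_length_le[OF \<phi>, of n Z]) auto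
      then show "enat n \<le> enat (DIM('a))"
        by simp
    qed
  qed
  then show ?thesis
    by (simp add: semialg_dim_def V_def)
qed

subsection \<open>Orbits of tensors\<close>

abbreviation mat22 :: "real \<Rightarrow> real \<Rightarrow> real \<Rightarrow> real \<Rightarrow> real ^ 2 ^ 2" where
  "mat22 a b c d \<equiv> vector [vector [a, b], vector [c, d]]"

lemma mat22_exhaust:
  obtains a b c d where "A = mat22 a b c d"
proof
  show "A = mat22 (A $ 1 $ 1) (A $ 1 $ 2) (A $ 2 $ 1) (A $ 2 $ 2)"
    by (simp add: vec_eq_iff forall_2)
qed

lemma invertible_mat22 [simp]: "invertible (mat22 a b c d) \<longleftrightarrow> a * d - b * c \<noteq> 0"
  by (simp add: invertible_det_nz det_2)

abbreviation (input) tensor_of :: "real ^ 2 ^ 2 \<Rightarrow> real ^ 2 ^ 2 \<Rightarrow> tensor" where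
  "tensor_of A B \<equiv> vector [A, B]"

lemma tensor_exhaust:
  fixes T :: tensor
  obtains A B where "T = tensor_of A B"
proof
  show "T = tensor_of (T $ 1) (T $ 2)"
    by (simp add: vec_eq_iff forall_2)
qed

lemma multilinear_mult_slice:
  "multilinear_mult U V W T $ a = V ** (U $ a $ 1 *\<^sub>R T $ 1 + U $ a $ 2 *\<^sub>R T $ 2) ** transpose W"
  by (simp add: multilinear_mult_def vec_eq_iff forall_2 sum_2 matrix_matrix_mult_def transpose_def
      algebra_simps)

lemma linear_combination_sandwich:
  fixes V W X Y :: "real ^ 2 ^ 2"
  shows "x *\<^sub>R (V ** X ** W) + y *\<^sub>R (V ** Y ** W) = V ** (x *\<^sub>R X + y *\<^sub>R Y) ** W"
  by (simp add: vec_eq_iff forall_2 matrix_matrix_mult_def sum_2 algebra_simps)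

lemma multilinear_mult_compose:
  "multilinear_mult U V W (multilinear_mult U' V' W' T) =
    multilinear_mult (U ** U') (V ** V') (W ** W') T"
proof -
  have "multilinear_mult U V W (multilinear_mult U' V' W' T) $ a =
      multilinear_mult (U ** U') (V ** V') (W ** W') T $ a" for a
  proof -
    obtain A B where T: "T = tensor_of A B"
      by (rule tensor_exhaust)
    have "(U ** U') $ a $ i = U $ a $ 1 * U' $ 1 $ i + U $ a $ 2 * U' $ 2 $ i" for i
      by (simp add: matrix_matrix_mult_def sum_2)
    moreover have "x *\<^sub>R (y *\<^sub>R X + z *\<^sub>R Y) + x' *\<^sub>R (y' *\<^sub>R X + z' *\<^sub>R Y) =
        (x * y + x' * y') *\<^sub>R X + (x * z + x' * z') *\<^sub>R Y"
      for x y z x' y' z' and X Y :: "real ^ 2 ^ 2"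
      by (simp add: algebra_simps)
    ultimately show ?thesis
      by (simp add: multilinear_mult_slice matrix_transpose_mul matrix_mul_assoc T
          linear_combination_sandwich)
  qed
  then show ?thesis
    by (simp add: vec_eq_iff)
qed

lemma multilinear_mult_one [simp]: "multilinear_mult (mat 1) (mat 1) (mat 1) T = T"
  by (simp add: multilinear_mult_def vec_eq_iff forall_2 sum_2 mat_def)

lemma GL_orbitI:
  assumes "T = multilinear_mult U V W S" "invertible U" "invertible V" "invertible W"
  shows "T \<in> GL_orbit S"
  using assms by (auto simp: GL_orbit_def)

lemma invertible_mat_1 [simp]: "invertible (mat 1 :: real ^ 'n ^ 'n)"
  by (auto simp: invertible_def)

lemma GL_orbit_refl: "T \<in> GL_orbit T"
  by (rule GL_orbitI[of _ "mat 1" "mat 1" "mat 1"]) auto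

lemma GL_orbit_trans: "R \<in> GL_orbit S \<Longrightarrow> S \<in> GL_orbit T \<Longrightarrow> R \<in> GL_orbit T"
  unfolding GL_orbit_def by (clarsimp simp: multilinear_mult_compose) (blast intro: invertible_mult)

lemma GL_orbit_sym: "S \<in> GL_orbit T \<Longrightarrow> T \<in> GL_orbit S"
proof -
  assume "S \<in> GL_orbit T"
  then obtain U V W where *: "S = multilinear_mult U V W T" "invertible U" "invertible V" "invertible W"
    by (auto simp: GL_orbit_def)
  then obtain U' V' W' where "U' ** U = mat 1" "U ** U' = mat 1" "V' ** V = mat 1" "V ** V' = mat 1"
      "W' ** W = mat 1" "W ** W' = mat 1"
    unfolding invertible_def by metis
  then show ?thesis
    by (intro GL_orbitI[of _ U' V' W']) (auto simp: *(1) multilinear_mult_compose invertible_def)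
qed

lemma GL_orbit_eq_iff: "GL_orbit S = GL_orbit T \<longleftrightarrow> S \<in> GL_orbit T"
  using GL_orbit_refl GL_orbit_sym GL_orbit_trans by blast

lemma multilinear_mult_in_GL_orbit_iff:
  assumes "invertible U" "invertible V" "invertible W"
  shows "multilinear_mult U V W T \<in> GL_orbit S \<longleftrightarrow> T \<in> GL_orbit S"
  using GL_orbitI[OF refl assms] GL_orbit_sym GL_orbit_trans by blast

definition swap12 :: "tensor \<Rightarrow> tensor" where
  "swap12 T = (\<chi> i j k. T $ j $ i $ k)"

definition swap13 :: "tensor \<Rightarrow> tensor" where
  "swap13 T = (\<chi> i j k. T $ k $ j $ i)"

lemma swap_nth [simp]:
  "swap12 T $ i $ j $ k = T $ j $ i $ k"
  "swap13 T $ i $ j $ k = T $ k $ j $ i"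
  by (simp_all add: swap12_def swap13_def)

lemma swap_swap [simp]: "swap12 (swap12 T) = T" "swap13 (swap13 T) = T"
  by (simp_all add: vec_eq_iff)

lemma swap_multilinear_mult:
  "swap12 (multilinear_mult U V W T) = multilinear_mult V U W (swap12 T)"
  "swap13 (multilinear_mult U V W T) = multilinear_mult W V U (swap13 T)"
  by (simp_all add: vec_eq_iff multilinear_mult_def forall_2 sum_2 mult_ac add_ac)

lemma swap_GL_orbit:
  "T \<in> GL_orbit S \<Longrightarrow> swap12 T \<in> GL_orbit (swap12 S)"
  "T \<in> GL_orbit S \<Longrightarrow> swap13 T \<in> GL_orbit (swap13 S)"
  unfolding GL_orbit_def by (clarsimp simp: swap_multilinear_mult; blast)+

lemma E_nth [simp]: "E i j k $ a $ b $ c = (if a = i \<and> b = j \<and> c = k then 1 else 0)"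
  by (simp add: E_def axis_def)

lemma swap_canonical:
  "swap12 0 = 0" "swap12 (E 1 1 1) = E 1 1 1" "swap12 (E 1 1 1 + E 1 2 2) = E 1 1 1 + E 2 1 2"
  "swap13 0 = 0" "swap13 (E 1 1 1) = E 1 1 1" "swap13 (E 1 1 1 + E 1 2 2) = E 1 1 1 + E 2 2 1"
  by (simp_all add: vec_eq_iff forall_2)

lemma D2''_eq_swap: "D2'' = swap12 ` D2'"
proof -
  have "x \<in> swap12 ` GL_orbit (E 1 1 1 + E 1 2 2)" if "x \<in> GL_orbit (E 1 1 1 + E 2 1 2)" for x
    using swap_GL_orbit(1)[OF that] swap_canonical(3)
    by (intro image_eqI[of _ _ "swap12 x"]) (simp, metis swap_swap(1))
  then show ?thesis
    using swap_GL_orbit(1)[of _ "E 1 1 1 + E 1 2 2"] swap_canonical(3)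
    by (auto simp: D2'_def D2''_def)
qed

lemma D2_eq_swap: "D2 = swap13 ` D2'"
proof -
  have "x \<in> swap13 ` GL_orbit (E 1 1 1 + E 1 2 2)" if "x \<in> GL_orbit (E 1 1 1 + E 2 2 1)" for x
    using swap_GL_orbit(2)[OF that] swap_canonical(6)
    by (intro image_eqI[of _ _ "swap13 x"]) (simp, metis swap_swap(2))
  then show ?thesis
    using swap_GL_orbit(2)[of _ "E 1 1 1 + E 1 2 2"] swap_canonical(6)
    by (auto simp: D2'_def D2_def)
qed

subsection \<open>Invariants of the orbits\<close>

definition degenerate :: "tensor \<Rightarrow> bool" where
  "degenerate T \<longleftrightarrow> (\<exists>x y. (x \<noteq> 0 \<or> y \<noteq> 0) \<and> x *\<^sub>R T $ 1 + y *\<^sub>R T $ 2 = 0)"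

lemma degenerate_multilinear_mult:
  assumes "degenerate T" and U: "invertible U"
  shows "degenerate (multilinear_mult U V W T)"
proof -
  obtain x y where xy: "x \<noteq> 0 \<or> y \<noteq> 0" "x *\<^sub>R T $ 1 + y *\<^sub>R T $ 2 = 0"
    using assms(1) by (auto simp: degenerate_def)
  obtain a b c d where u: "U = mat22 a b c d"
    by (rule mat22_exhaust)
  have det: "a * d - b * c \<noteq> 0"
    using U by (simp add: u)
  define x' y' where "x' = x * d - y * c" and "y' = y * a - x * b"
  have "x' * a + y' * c = (a * d - b * c) * x" "x' * b + y' * d = (a * d - b * c) * y"
    by (simp_all add: x'_def y'_def algebra_simps)
  moreover from this have "x' \<noteq> 0 \<or> y' \<noteq> 0"
    using det xy(1) by auto
  moreover have "x' *\<^sub>R multilinear_mult U V W T $ 1 + y' *\<^sub>R multilinear_mult U V W T $ 2 =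
      V ** ((x' * a + y' * c) *\<^sub>R T $ 1 + (x' * b + y' * d) *\<^sub>R T $ 2) ** transpose W"
    by (simp add: multilinear_mult_slice u linear_combination_sandwich) (simp add: algebra_simps)
  moreover have "(t * x) *\<^sub>R T $ 1 + (t * y) *\<^sub>R T $ 2 = 0" for t
    using arg_cong[OF xy(2), of "\<lambda>z. t *\<^sub>R z"] by (simp add: algebra_simps)
  ultimately show ?thesis
    unfolding degenerate_def by (intro exI[of _ x'] exI[of _ y']) simp
qed

lemma degenerate_in_GL_orbit: "S \<in> GL_orbit T \<Longrightarrow> degenerate T \<Longrightarrow> degenerate S"
  by (auto simp: GL_orbit_def intro: degenerate_multilinear_mult)

definition hyperdet :: "tensor \<Rightarrow> real" where
  "hyperdet T =
    (T $ 1 $ 1 $ 1 * T $ 2 $ 2 $ 2 + T $ 1 $ 2 $ 2 * T $ 2 $ 1 $ 1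
      - T $ 1 $ 1 $ 2 * T $ 2 $ 2 $ 1 - T $ 1 $ 2 $ 1 * T $ 2 $ 1 $ 2)\<^sup>2
    - 4 * det (T $ 1) * det (T $ 2)"

lemma hyperdet_swap: "hyperdet (swap12 T) = hyperdet T" "hyperdet (swap13 T) = hyperdet T"
  by (simp_all add: hyperdet_def det_2 power2_eq_square algebra_simps)

lemma hyperdet_multilinear_mult_mode1:
  "hyperdet (multilinear_mult U (mat 1) (mat 1) T) = (det U)\<^sup>2 * hyperdet T"
  by (simp add: hyperdet_def det_2 multilinear_mult_def sum_2 mat_def power2_eq_square algebra_simps)

lemma hyperdet_multilinear_mult:
  "hyperdet (multilinear_mult U V W T) = (det U * det V * det W)\<^sup>2 * hyperdet T"
proof -
  have "multilinear_mult U V W T = multilinear_mult U (mat 1) (mat 1)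
      (swap12 (multilinear_mult V (mat 1) (mat 1)
        (swap12 (swap13 (multilinear_mult W (mat 1) (mat 1) (swap13 T))))))"
    by (simp add: swap_multilinear_mult multilinear_mult_compose)
  then show ?thesis
    by (simp add: hyperdet_multilinear_mult_mode1 hyperdet_swap power_mult_distrib)
qed

definition signature :: "tensor \<Rightarrow> bool \<times> bool \<times> bool \<times> bool \<times> real" where
  "signature T =
    (T = 0, degenerate T, degenerate (swap12 T), degenerate (swap13 T), sgn (hyperdet T))"

lemma signature_eq_if_in_GL_orbit:
  assumes "S \<in> GL_orbit T"
  shows "signature S = signature T"
proof -
  have zero: "S = 0" if "S \<in> GL_orbit T" "T = 0" for S T :: tensor
    using that by (auto simp: GL_orbit_def multilinear_mult_def vec_eq_iff)
  have "degenerate S \<longleftrightarrow> degenerate T" if "S \<in> GL_orbit T" for S T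
    using degenerate_in_GL_orbit GL_orbit_sym that by blast
  moreover have "S = 0 \<longleftrightarrow> T = 0"
    using zero assms GL_orbit_sym by blast
  moreover have "sgn (hyperdet S) = sgn (hyperdet T)"
  proof -
    obtain U V W where S: "S = multilinear_mult U V W T"
      and "det U * det V * det W \<noteq> 0"
      using assms by (auto simp: GL_orbit_def invertible_det_nz)
    then have "0 < (det U * det V * det W)\<^sup>2"
      by simp
    then show ?thesis
      unfolding S hyperdet_multilinear_mult sgn_mult[of "(_)\<^sup>2"] by (simp only: sgn_pos mult_1)
  qed
  ultimately show ?thesis
    unfolding signature_def using assms swap_GL_orbit by blast
qed

lemma degenerate_iff:
  "degenerate T \<longleftrightarrow> (\<exists>x y. (x \<noteq> 0 \<or> y \<noteq> 0) \<and> (\<forall>j k. x * T $ 1 $ j $ k + y * T $ 2 $ j $ k = 0))"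
  by (simp add: degenerate_def vec_eq_iff)

lemma signature_canonical:
  "signature 0 = (True, True, True, True, 0)"
  "signature (E 1 1 1) = (False, True, True, True, 0)"
  "signature (E 1 1 1 + E 2 2 1) = (False, False, False, True, 0)"
  "signature (E 1 1 1 + E 1 2 2) = (False, True, False, False, 0)"
  "signature (E 1 1 1 + E 2 1 2) = (False, False, True, False, 0)"
  "signature (E 1 1 1 + E 1 2 2 + E 2 1 2) = (False, False, False, False, 0)"
  "signature (E 1 1 1 + E 2 2 2) = (False, False, False, False, 1)"
  "signature (E 1 1 1 + E 2 2 1 - E 1 2 2 + E 2 1 2) = (False, False, False, False, - 1)"
  by (auto simp: signature_def degenerate_iff hyperdet_def det_2 vec_eq_iff forall_2)

lemma distinct_orbits: "distinct [D0, D1, D2, D2', D2'', D3, G2, G3]"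
proof -
  let ?L = "[0, E 1 1 1, E 1 1 1 + E 2 2 1, E 1 1 1 + E 1 2 2, E 1 1 1 + E 2 1 2,
    E 1 1 1 + E 1 2 2 + E 2 1 2, E 1 1 1 + E 2 2 2, E 1 1 1 + E 2 2 1 - E 1 2 2 + E 2 1 2]"
  have "distinct (map signature ?L)"
    by (simp add: signature_canonical)
  then have "distinct ?L" "inj_on signature (set ?L)"
    by (simp_all add: distinct_map del: distinct.simps list.map list.set)
  moreover have "inj_on GL_orbit (set ?L)"
    using \<open>inj_on signature (set ?L)\<close> signature_eq_if_in_GL_orbit
    by (auto simp: inj_on_def GL_orbit_eq_iff simp del: list.set)
  ultimately have "distinct (map GL_orbit ?L)"
    by (simp add: distinct_map del: distinct.simps list.map list.set)
  then show ?thesis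
    by (simp add: D0_def D1_def D2_def D2'_def D2''_def D3_def G2_def G3_def)
qed

subsection \<open>Classification of tensors\<close>

lemma ex_invertible_first_column:
  assumes "x \<noteq> 0 \<or> y \<noteq> (0::real)"
  obtains b d where "invertible (mat22 x b y d)"
proof
  have "x * x + y * y \<noteq> 0"
    using assms by (simp add: sum_squares_eq_zero_iff)
  then show "invertible (mat22 x (- y) y x)"
    by simp
qed

lemma det_eq_0_imp_outer_product:
  fixes a b c d :: real
  assumes "a * d = b * c"
  obtains v1 v2 w1 w2 where "a = v1 * w1" "b = v1 * w2" "c = v2 * w1" "d = v2 * w2"
proof (cases "a = 0 \<and> b = 0")
  case True
  then show ?thesis
    using that[of 0 c d 1] that[of 0 1 c d] by (metis mult_1 mult_zero_left)
next
  case False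
  then consider "a \<noteq> 0" | "b \<noteq> 0"
    by auto
  then show ?thesis
  proof cases
    case 1
    then show ?thesis
      using assms that[of 1 a b "c / a"] by (simp add: field_simps)
  next
    case 2
    then show ?thesis
      using assms that[of 1 a b "d / b"] by (simp add: field_simps)
  qed
qed

lemma outer_product_in_D1:
  assumes "x1 \<noteq> 0 \<or> x2 \<noteq> 0" "y1 \<noteq> 0 \<or> y2 \<noteq> 0" "z1 \<noteq> 0 \<or> z2 \<noteq> 0"
  shows "tensor_of (mat22 (x1 * y1 * z1) (x1 * y1 * z2) (x1 * y2 * z1) (x1 * y2 * z2))
    (mat22 (x2 * y1 * z1) (x2 * y1 * z2) (x2 * y2 * z1) (x2 * y2 * z2)) \<in> D1"
proof -
  obtain u1 u2 where U: "invertible (mat22 x1 u1 x2 u2)"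
    using ex_invertible_first_column[OF assms(1)] .
  obtain v1 v2 where V: "invertible (mat22 y1 v1 y2 v2)"
    using ex_invertible_first_column[OF assms(2)] .
  obtain w1 w2 where W: "invertible (mat22 z1 w1 z2 w2)"
    using ex_invertible_first_column[OF assms(3)] .
  show ?thesis
    unfolding D1_def using _ U V W
    by (rule GL_orbitI) (simp add: vec_eq_iff forall_2 multilinear_mult_def sum_2)
qed

lemma degenerate_cases:
  assumes "degenerate T"
  shows "T \<in> D0 \<union> D1 \<union> D2'"
proof -
  obtain x y where xy: "x \<noteq> 0 \<or> y \<noteq> 0" and *: "x *\<^sub>R T $ 1 + y *\<^sub>R T $ 2 = 0"
    using assms by (auto simp: degenerate_def)
  define U where "U = mat22 (- y) x x y"
  have "x * x + y * y \<noteq> 0"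
    using xy by (simp add: sum_squares_eq_zero_iff)
  then have U: "invertible U"
    by (simp add: U_def add_eq_0_iff algebra_simps)
  define T' where "T' = multilinear_mult U (mat 1) (mat 1) T"
  have T': "T \<in> GL_orbit S \<longleftrightarrow> T' \<in> GL_orbit S" for S
    unfolding T'_def using U
    by (subst multilinear_mult_in_GL_orbit_iff) auto
  have T'2: "T' $ 2 = 0"
    using * by (simp add: T'_def multilinear_mult_slice U_def)
  obtain a b c d where "T' $ 1 = mat22 a b c d"
    by (rule mat22_exhaust)
  then have T'_eq: "T' = tensor_of (mat22 a b c d) 0"
    using T'2 by (simp add: vec_eq_iff forall_2)
  show ?thesis
  proof (cases "a * d = b * c")
    case False
    then have "T' \<in> D2'"
      unfolding D2'_def T'_eq
      by (intro GL_orbitI[of _ "mat 1" "mat22 a b c d" "mat 1"])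
        (auto simp: vec_eq_iff forall_2 multilinear_mult_def sum_2 mat_def invertible_det_nz det_2)
    then show ?thesis
      using T' by (simp add: D2'_def)
  next
    case True
    then obtain v1 v2 w1 w2 where vw: "a = v1 * w1" "b = v1 * w2" "c = v2 * w1" "d = v2 * w2"
      by (rule det_eq_0_imp_outer_product)
    show ?thesis
    proof (cases "(v1 \<noteq> 0 \<or> v2 \<noteq> 0) \<and> (w1 \<noteq> 0 \<or> w2 \<noteq> 0)")
      case True
      have "T' = tensor_of (mat22 (1 * v1 * w1) (1 * v1 * w2) (1 * v2 * w1) (1 * v2 * w2))
          (mat22 (0 * v1 * w1) (0 * v1 * w2) (0 * v2 * w1) (0 * v2 * w2))"
        by (simp add: T'_eq vw vec_eq_iff forall_2)
      also have "\<dots> \<in> D1"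
        using True by (intro outer_product_in_D1) auto
      finally show ?thesis
        using T' by (simp add: D1_def)
    next
      case False
      then have "T' = 0"
        by (auto simp: T'_eq vw vec_eq_iff forall_2)
      then have "T' \<in> GL_orbit 0"
        using GL_orbit_refl by simp
      then show ?thesis
        using T' by (simp add: D0_def)
    qed
  qed
qed

lemma swap_degenerate_cases:
  "degenerate (swap12 T) \<Longrightarrow> T \<in> D0 \<union> D1 \<union> D2''"
  "degenerate (swap13 T) \<Longrightarrow> T \<in> D0 \<union> D1 \<union> D2"
proof -
  have "T \<in> GL_orbit (swap12 S)" if "swap12 T \<in> GL_orbit S" for S
    using swap_GL_orbit(1)[OF that] by simp
  from this[of 0] this[of "E 1 1 1"] this[of "E 1 1 1 + E 1 2 2"]
  show "degenerate (swap12 T) \<Longrightarrow> T \<in> D0 \<union> D1 \<union> D2''"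
    using degenerate_cases[of "swap12 T"]
    unfolding D0_def D1_def D2'_def D2''_def swap_canonical by blast
  have "T \<in> GL_orbit (swap13 S)" if "swap13 T \<in> GL_orbit S" for S
    using swap_GL_orbit(2)[OF that] by simp
  from this[of 0] this[of "E 1 1 1"] this[of "E 1 1 1 + E 1 2 2"]
  show "degenerate (swap13 T) \<Longrightarrow> T \<in> D0 \<union> D1 \<union> D2"
    using degenerate_cases[of "swap13 T"]
    unfolding D0_def D1_def D2'_def D2_def swap_canonical by blast
qed

lemma degenerate_if_singular_pencil:
  assumes "\<And>x y. det (x *\<^sub>R T $ 1 + y *\<^sub>R T $ 2) = 0"
  shows "degenerate T \<or> degenerate (swap12 T) \<or> degenerate (swap13 T)"
proof -
  obtain A B where T: "T = tensor_of A B"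
    by (rule tensor_exhaust)
  obtain a1 a2 a3 a4 b1 b2 b3 b4 where AB: "A = mat22 a1 a2 a3 a4" "B = mat22 b1 b2 b3 b4"
    by (metis mat22_exhaust)
  have "a1 * a4 = a2 * a3" "b1 * b4 = b2 * b3"
    using assms[of 1 0] assms[of 0 1] by (simp_all add: T AB det_2)
  then obtain v1 v2 w1 w2 v1' v2' w1' w2' where
    a: "a1 = v1 * w1" "a2 = v1 * w2" "a3 = v2 * w1" "a4 = v2 * w2" and
    b: "b1 = v1' * w1'" "b2 = v1' * w2'" "b3 = v2' * w1'" "b4 = v2' * w2'"
    by (elim det_eq_0_imp_outer_product) blast
  have "(v1 * v2' - v2 * v1') * (w1 * w2' - w2 * w1') = 0"
    using assms[of 1 1] by (simp add: T AB a b det_2 algebra_simps)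
  then consider "v1 * v2' = v2 * v1'" | "w1 * w2' = w2 * w1'"
    by auto
  then show ?thesis
  proof cases
    case 1
    show ?thesis
    proof (cases "v1 = 0 \<and> v2 = 0")
      case True
      then have "degenerate T"
        unfolding degenerate_iff forall_2
        by - (rule exI[of _ 1], rule exI[of _ 0], simp add: T AB a b)
      then show ?thesis ..
    next
      case False
      have "degenerate (swap12 T)"
        unfolding degenerate_iff forall_2 using False 1
        by - (rule exI[of _ v2], rule exI[of _ "- v1"], auto simp: T AB a b)
      then show ?thesis
        by simp
    qed
  next
    case 2
    show ?thesis
    proof (cases "w1 = 0 \<and> w2 = 0")
      case True
      then have "degenerate T"
        unfolding degenerate_iff forall_2
        by - (rule exI[of _ 1], rule exI[of _ 0], simp add: T AB a b)
      then show ?thesis ..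
    next
      case False
      have "degenerate (swap13 T)"
        unfolding degenerate_iff forall_2 using False 2
        by - (rule exI[of _ w2], rule exI[of _ "- w1"], auto simp: T AB a b)
      then show ?thesis
        by simp
    qed
  qed
qed

lemma mat_nth: "mat c $ i $ j = (if i = j then c else 0)"
  by (simp add: mat_def)

definition companion_pencil :: "real \<Rightarrow> tensor" where
  "companion_pencil \<delta> = tensor_of (mat 1) (mat22 0 \<delta> 1 0)"

text \<open>A vector \<open>p\<close> that is not an eigenvector of the traceless matrix gives the basis \<open>p, N p\<close>,
  in which \<open>N\<close> becomes a companion matrix.\<close>

lemma traceless_pencil_in_orbit_companion:
  assumes "a \<noteq> 0 \<or> b \<noteq> 0 \<or> c \<noteq> 0"
  shows "tensor_of (mat 1) (mat22 a b c (- a)) \<in> GL_orbit (companion_pencil (a\<^sup>2 + b * c))"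
proof -
  have "\<exists>p q. p * (c * p - a * q) - (a * p + b * q) * q \<noteq> 0"
    using assms
  proof (elim disjE)
    assume "a \<noteq> 0"
    show ?thesis
    proof (cases "c = 0 \<and> b = 0")
      case True
      then show ?thesis
        using \<open>a \<noteq> 0\<close> by (intro exI[of _ 1]) simp
    next
      case False
      then show ?thesis
        by (metis (no_types, opaque_lifting) diff_zero diff_0 mult_1_right mult_zero_right add_0
            add.right_neutral neg_equal_0_iff_equal mult_1 mult_zero_left)
    qed
  next
    assume "b \<noteq> 0"
    then show ?thesis
      by (intro exI[of _ 0] exI[of _ 1]) simp
  next
    assume "c \<noteq> 0"
    then show ?thesis
      by (intro exI[of _ 1] exI[of _ 0]) simp
  qed
  then obtain p q where pq: "p * (c * p - a * q) - (a * p + b * q) * q \<noteq> 0"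
    by blast
  define P where "P = mat22 p (a * p + b * q) q (c * p - a * q)"
  have P: "invertible P"
    using pq by (simp add: P_def)
  then obtain P' where PP': "P ** P' = mat 1" "P' ** P = mat 1"
    unfolding invertible_def by blast
  have "P ** mat22 0 (a\<^sup>2 + b * c) 1 0 = mat22 a b c (- a) ** P"
    by (simp add: P_def vec_eq_iff forall_2 matrix_matrix_mult_def sum_2 power2_eq_square
        algebra_simps)
  then have "P ** mat22 0 (a\<^sup>2 + b * c) 1 0 ** P' = mat22 a b c (- a)"
    by (metis PP'(1) matrix_mul_assoc matrix_mul_rid)
  then have "tensor_of (mat 1) (mat22 a b c (- a)) =
      multilinear_mult (mat 1) P (transpose P') (companion_pencil (a\<^sup>2 + b * c))"
    by (subst vec_eq_iff)
      (simp add: forall_2 multilinear_mult_slice companion_pencil_def mat_nth PP')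
  moreover have "invertible P'"
    using PP' by (auto simp: invertible_def)
  ultimately show ?thesis
    using P by (metis GL_orbitI transpose_invertible invertible_mat_1)
qed

lemma nondegenerate_in_orbit_companion:
  assumes nd: "\<not> degenerate T" "\<not> degenerate (swap12 T)" "\<not> degenerate (swap13 T)"
  obtains \<delta> where "T \<in> GL_orbit (companion_pencil \<delta>)"
proof -
  obtain x y where det: "det (x *\<^sub>R T $ 1 + y *\<^sub>R T $ 2) \<noteq> 0"
    using degenerate_if_singular_pencil nd by blast
  define A B where "A = x *\<^sub>R T $ 1 + y *\<^sub>R T $ 2" and "B = x *\<^sub>R T $ 2 - y *\<^sub>R T $ 1"
  have A: "invertible A"
    using det by (simp add: A_def invertible_det_nz)
  then obtain A' where A': "A' ** A = mat 1" "invertible A'"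
    unfolding invertible_def by blast
  obtain a b c d where N: "A' ** B = mat22 a b c d"
    by (rule mat22_exhaust)
  define t where "t = (a + d) / 2"
  define U where "U = mat22 x y (- y - t * x) (x - t * y)"
  have "x * x + y * y \<noteq> 0"
    using det by (auto simp: sum_squares_eq_zero_iff det_2)
  then have U: "invertible U"
    by (simp add: U_def algebra_simps)
  have "multilinear_mult U A' (mat 1) T = tensor_of (mat 1) (mat22 (a - t) b c (- (a - t)))"
  proof -
    have "(- y - t * x) *\<^sub>R T $ 1 + (x - t * y) *\<^sub>R T $ 2 = B - t *\<^sub>R A"
      by (simp add: A_def B_def algebra_simps)
    moreover have "A' ** (B - t *\<^sub>R A) = mat22 a b c d - t *\<^sub>R mat 1"
      using linear_combination_sandwich[of 1 A' B "mat 1" "- t" A] by (simp add: N A')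
    moreover have "mat22 a b c d - t *\<^sub>R mat 1 = mat22 (a - t) b c (- (a - t))"
      by (simp add: vec_eq_iff forall_2 mat_def t_def field_simps)
    moreover have "A' ** (x *\<^sub>R T $ 1 + y *\<^sub>R T $ 2) = mat 1"
      using A' by (simp add: A_def)
    ultimately show ?thesis
      by (subst vec_eq_iff) (simp add: forall_2 multilinear_mult_slice U_def)
  qed
  moreover have "a - t \<noteq> 0 \<or> b \<noteq> 0 \<or> c \<noteq> 0"
  proof (rule ccontr)
    assume "\<not> ?thesis"
    then have "degenerate (multilinear_mult U A' (mat 1) T)"
      unfolding calculation
      unfolding degenerate_iff forall_2 by - (rule exI[of _ 0], rule exI[of _ 1], simp)
    moreover have "T \<in> GL_orbit (multilinear_mult U A' (mat 1) T)"
      using U A' by (intro GL_orbit_sym[OF GL_orbitI[OF refl]]) auto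
    ultimately have "degenerate T"
      using degenerate_in_GL_orbit by blast
    then show False
      using nd by simp
  qed
  ultimately have "multilinear_mult U A' (mat 1) T \<in> GL_orbit (companion_pencil ((a - t)\<^sup>2 + b * c))"
    using traceless_pencil_in_orbit_companion by (simp only:)
  then have "T \<in> GL_orbit (companion_pencil ((a - t)\<^sup>2 + b * c))"
    using U A' by (subst (asm) multilinear_mult_in_GL_orbit_iff) auto
  then show ?thesis
    by (rule that)
qed

lemma companion_pencil_rescale:
  assumes "s \<noteq> 0"
  shows "companion_pencil (\<epsilon> * s\<^sup>2) \<in> GL_orbit (companion_pencil \<epsilon>)"
  by (rule GL_orbitI[of _ "mat22 1 0 0 s" "mat22 s 0 0 1" "mat22 (1 / s) 0 0 1"])
    (use assms in \<open>auto simp: companion_pencil_def vec_eq_iff forall_2 multilinear_mult_def sum_2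
      mat_def power2_eq_square\<close>)

lemma companion_pencil_0_in_D3: "companion_pencil 0 \<in> D3"
  unfolding D3_def
  by (rule GL_orbitI[of _ "mat 1" "mat22 0 1 1 0" "mat22 0 1 1 0"])
    (auto simp: companion_pencil_def vec_eq_iff forall_2 multilinear_mult_def sum_2 mat_def
      invertible_det_nz det_2)

lemma companion_pencil_1_in_G2: "companion_pencil 1 \<in> G2"
  unfolding G2_def
  by (rule GL_orbitI[of _ "mat22 (1/2) (1/2) (1/2) (-1/2)" "mat22 1 1 1 (-1)" "mat22 1 1 1 (-1)"])
    (auto simp: companion_pencil_def vec_eq_iff forall_2 multilinear_mult_def sum_2 mat_def)

lemma companion_pencil_minus_1_in_G3: "companion_pencil (- 1) \<in> G3"
  unfolding G3_def
  by (rule GL_orbitI[of _ "mat22 1 0 0 (-1)" "mat22 1 0 0 (-1)" "mat 1"])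
    (auto simp: companion_pencil_def vec_eq_iff forall_2 multilinear_mult_def sum_2 mat_def
      invertible_det_nz det_2)

lemma nondegenerate_cases:
  assumes "\<not> degenerate T" "\<not> degenerate (swap12 T)" "\<not> degenerate (swap13 T)"
  shows "T \<in> D3 \<union> G2 \<union> G3"
proof -
  obtain \<delta> where \<delta>: "T \<in> GL_orbit (companion_pencil \<delta>)"
    using assms by (rule nondegenerate_in_orbit_companion)
  consider "\<delta> = 0" | "\<delta> > 0" | "\<delta> < 0"
    by linarith
  then show ?thesis
  proof cases
    case 1
    then show ?thesis
      using \<delta> companion_pencil_0_in_D3 GL_orbit_trans by (auto simp: D3_def)
  next
    case 2
    then have "companion_pencil \<delta> \<in> GL_orbit (companion_pencil 1)"
      using companion_pencil_rescale[of "sqrt \<delta>" 1] by simp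
    then show ?thesis
      using \<delta> companion_pencil_1_in_G2 GL_orbit_trans unfolding G2_def by blast
  next
    case 3
    then have "companion_pencil \<delta> \<in> GL_orbit (companion_pencil (- 1))"
      using companion_pencil_rescale[of "sqrt (- \<delta>)" "- 1"] by simp
    then show ?thesis
      using \<delta> companion_pencil_minus_1_in_G3 GL_orbit_trans unfolding G3_def by blast
  qed
qed

lemma orbits_cover: "T \<in> D0 \<union> D1 \<union> D2 \<union> D2' \<union> D2'' \<union> D3 \<union> G2 \<union> G3"
  using degenerate_cases[of T] swap_degenerate_cases[of T] nondegenerate_cases[of T] by blast

lemma partition_orbits: "partition_on UNIV {D0, D1, D2, D2', D2'', D3, G2, G3}"
proof (rule partition_onI)
  show "\<Union> {D0, D1, D2, D2', D2'', D3, G2, G3} = UNIV"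
    using orbits_cover by auto
  have orbit: "\<exists>T. X = GL_orbit T" if "X \<in> {D0, D1, D2, D2', D2'', D3, G2, G3}" for X
    using that unfolding D0_def D1_def D2_def D2'_def D2''_def D3_def G2_def G3_def by blast
  show "{} \<notin> {D0, D1, D2, D2', D2'', D3, G2, G3}"
    using orbit[of "{}"] GL_orbit_refl by blast
  show "disjnt p q" if "p \<in> {D0, D1, D2, D2', D2'', D3, G2, G3}"
    "q \<in> {D0, D1, D2, D2', D2'', D3, G2, G3}" "p \<noteq> q" for p q
    using orbit[OF that(1)] orbit[OF that(2)] that(3) GL_orbit_sym GL_orbit_trans
    unfolding disjnt_iff by blast
qed

lemma sgn_hyperdet:
  "T \<in> D0 \<union> D1 \<union> D2 \<union> D2' \<union> D2'' \<union> D3 \<Longrightarrow> hyperdet T = 0"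
  "T \<in> G2 \<Longrightarrow> hyperdet T > 0"
  "T \<in> G3 \<Longrightarrow> hyperdet T < 0"
proof -
  have *: "sgn (hyperdet T) = snd (snd (snd (snd (signature S))))" if "T \<in> GL_orbit S" for S
    using signature_eq_if_in_GL_orbit[OF that] by (auto simp: signature_def)
  show "T \<in> D0 \<union> D1 \<union> D2 \<union> D2' \<union> D2'' \<union> D3 \<Longrightarrow> hyperdet T = 0"
    unfolding D0_def D1_def D2_def D2'_def D2''_def D3_def
    by (auto dest!: * simp: signature_canonical sgn_zero_iff)
  show "T \<in> G2 \<Longrightarrow> hyperdet T > 0"
    unfolding G2_def by (auto dest!: * simp: signature_canonical sgn_1_pos)
  show "T \<in> G3 \<Longrightarrow> hyperdet T < 0"
    unfolding G3_def by (auto dest!: * simp: signature_canonical sgn_1_neg)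
qed

lemma in_G2_if_hyperdet_pos: "hyperdet T > 0 \<Longrightarrow> T \<in> G2"
  and in_G3_if_hyperdet_neg: "hyperdet T < 0 \<Longrightarrow> T \<in> G3"
  using orbits_cover[of T] sgn_hyperdet[of T] by auto

subsection \<open>Coordinates on parameter spaces\<close>

definition coord :: "real ^ 'n \<Rightarrow> nat \<Rightarrow> real" where
  "coord x i = (if i < CARD('n) then x $ (SOME h. bij_betw h {..<CARD('n)} UNIV) i else 0)"

lemma ex_coord_eq:
  assumes "\<And>i. i \<ge> CARD('n::finite) \<Longrightarrow> v i = 0"
  shows "\<exists>x :: real ^ 'n. coord x = v"
proof -
  define h :: "nat \<Rightarrow> 'n" where "h = (SOME h. bij_betw h {..<CARD('n)} UNIV)"
  have "\<exists>h :: nat \<Rightarrow> 'n. bij_betw h {..<CARD('n)} UNIV"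
    using ex_bij_betw_nat_finite[of "UNIV :: 'n set"] by (simp add: atLeast0LessThan)
  then have h: "bij_betw h {..<CARD('n)} UNIV"
    unfolding h_def by (rule someI_ex)
  have "coord (\<chi> j. v (inv_into {..<CARD('n)} h j)) i = v i" for i
    using assms[of i] bij_betw_inv_into_left[OF h, of i] by (simp add: coord_def flip: h_def)
  then show ?thesis
    by blast
qed

lemma linear_coord: "coord (x + y) i = coord x i + coord y i" "coord (c *\<^sub>R x) i = c * coord x i"
  by (simp_all add: coord_def)

lemma real_polynomial_function_coord: "real_polynomial_function (\<lambda>x :: real ^ 'n. coord x i)"
  by (cases "i < CARD('n)")
    (auto simp: coord_def intro!: real_polynomial_function.intros(1,2) bounded_linear_vec_nth)

lemma real_polynomial_function_nth: "real_polynomial_function (\<lambda>T :: tensor. T $ i $ j $ k)"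
  by (intro real_polynomial_function.intros(1) bounded_linear_compose[OF bounded_linear_vec_nth]
      bounded_linear_vec_nth)

lemma polynomial_function_tensor:
  assumes "\<forall>i j k. real_polynomial_function (\<lambda>x. f x $ i $ j $ k)"
  shows "polynomial_function (f :: 'a::real_normed_vector \<Rightarrow> tensor)"
  unfolding polynomial_function_iff_Basis_inner
  using assms by (auto simp: Basis_vec_def inner_axis real_polynomial_function_eq)

lemmas polynomial_intros = real_polynomial_function_coord real_polynomial_function_nth
  real_polynomial_function.intros(2-4) real_polynomial_function_diff real_polynomial_function_minus
  real_polynomial_function_power

lemma open_nonzero_real_polynomial:
  assumes "real_polynomial_function p"
  shows "open {x. p x \<noteq> 0}"
  using continuous_on_polymonial_function[of p UNIV] assms
  by (intro open_Collect_neq) (auto simp: real_polynomial_function_eq)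

text \<open>The chain of irreducible closed sets consists of the closures of the images of the
  coordinate subspaces \<open>v k = v (k + 1) = \<dots> = 0\<close>; the function \<open>fs ! k\<close> separates the \<open>k\<close>-th
  of them from the next one.\<close>

lemma semialg_dim_parametrization:
  fixes \<Phi> :: "(nat \<Rightarrow> real) \<Rightarrow> tensor"
  assumes \<Phi>: "polynomial_function (\<lambda>x :: real ^ 'n. \<Phi> (coord x))"
    and cl: "S \<subseteq> zariski closure_of (range (\<lambda>x :: real ^ 'n. \<Phi> (coord x)))"
      "range (\<lambda>x :: real ^ 'n. \<Phi> (coord x)) \<subseteq> zariski closure_of S"
    and fs: "length fs = CARD('n)" "\<forall>f\<in>set fs. real_polynomial_function f"
    and f0: "\<And>k v. k < CARD('n) \<Longrightarrow> (\<forall>i\<ge>k. v i = 0) \<Longrightarrow> (fs ! k) (\<Phi> v) = 0"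
    and f1: "\<And>k. k < CARD('n) \<Longrightarrow> (fs ! k) (\<Phi> (\<lambda>i. if i \<le> k then 1 else 0)) \<noteq> 0"
  shows "semialg_dim S = enat CARD('n)"
proof -
  define C where "C k = {x :: real ^ 'n. \<forall>i\<ge>k. coord x i = 0}" for k
  have "semialg_dim S = enat DIM(real ^ 'n)"
  proof (rule semialg_dim_eqI[OF \<Phi>, where C = C and f = "\<lambda>k. fs ! k"])
    show "convex (C k)" for k
      by (auto simp: C_def convex_def linear_coord)
    show "C k \<noteq> {}" for k
    proof -
      have "0 \<in> C k"
        by (simp add: C_def coord_def)
      then show ?thesis
        by blast
    qed
    show "C k \<subseteq> C (Suc k)" for k
      by (auto simp: C_def)
    fix k assume "k < DIM(real ^ 'n)"
    then have k: "k < CARD('n)"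
      by simp
    show "real_polynomial_function (fs ! k)"
      using fs k by auto
    show "(fs ! k) (\<Phi> (coord x)) = 0" if "x \<in> C k" for x
      using f0[OF k] that by (simp add: C_def)
    obtain x :: "real ^ 'n" where "coord x = (\<lambda>i. if i \<le> k then 1 else 0)"
      using ex_coord_eq[where 'n = 'n and v = "\<lambda>i. if i \<le> k then 1 else 0"] k by auto
    then show "\<exists>x\<in>C (Suc k). (fs ! k) (\<Phi> (coord x)) \<noteq> 0"
      using f1[OF k] by (intro bexI[of _ x]) (auto simp: C_def)
  qed (fact cl)+
  then show ?thesis
    by simp
qed

lemma range_subset_closure_if_generic:
  assumes "polynomial_function (\<lambda>x :: real ^ 'n. \<Phi> (coord x))"
    and Q: "real_polynomial_function (\<lambda>x :: real ^ 'n. Q (coord x))"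
    and v: "\<And>i. i \<ge> CARD('n) \<Longrightarrow> v i = 0" "Q v \<noteq> 0"
    and S: "\<And>v. Q v \<noteq> 0 \<Longrightarrow> \<Phi> v \<in> S"
  shows "range (\<lambda>x :: real ^ 'n. \<Phi> (coord x)) \<subseteq> zariski closure_of S"
proof (rule polynomial_image_subset_zariski_closure[OF assms(1) open_nonzero_real_polynomial[OF Q]])
  obtain x :: "real ^ 'n" where "coord x = v"
    using ex_coord_eq[where 'n = 'n and v = v] v(1) by blast
  then show "{x :: real ^ 'n. Q (coord x) \<noteq> 0} \<noteq> {}"
    using v(2) by auto
  show "\<Phi> (coord x) \<in> zariski closure_of S" if "x \<in> {x. Q (coord x) \<noteq> 0}" for x
    using S that closure_of_subset[of S zariski] by auto
qed

lemma GL_orbit_subset_closure_if_generic: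
  assumes R: "\<And>U V W. U $ 1 $ 1 \<noteq> 0 \<Longrightarrow> V $ 1 $ 1 \<noteq> 0 \<Longrightarrow> W $ 1 $ 1 \<noteq> 0 \<Longrightarrow> W $ 1 $ 2 \<noteq> 0 \<Longrightarrow>
    multilinear_mult U V W T \<in> R"
  shows "GL_orbit T \<subseteq> zariski closure_of R"
proof -
  define f where "f = (\<lambda>(U, V, W). multilinear_mult U V W T)"
  define G where "G = {(U :: real ^ 2 ^ 2, V :: real ^ 2 ^ 2, W :: real ^ 2 ^ 2).
    U $ 1 $ 1 \<noteq> 0 \<and> V $ 1 $ 1 \<noteq> 0 \<and> W $ 1 $ 1 \<noteq> 0 \<and> W $ 1 $ 2 \<noteq> 0}"
  have lin: "real_polynomial_function (\<lambda>X :: (real ^ 2 ^ 2) \<times> (real ^ 2 ^ 2) \<times> (real ^ 2 ^ 2). fst X $ i $ j)"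
    "real_polynomial_function (\<lambda>X :: (real ^ 2 ^ 2) \<times> (real ^ 2 ^ 2) \<times> (real ^ 2 ^ 2). fst (snd X) $ i $ j)"
    "real_polynomial_function (\<lambda>X :: (real ^ 2 ^ 2) \<times> (real ^ 2 ^ 2) \<times> (real ^ 2 ^ 2). snd (snd X) $ i $ j)"
    for i j
    by (intro real_polynomial_function.intros(1) bounded_linear_compose[OF bounded_linear_vec_nth]
      bounded_linear_intros)+
  have "polynomial_function f"
    by (rule polynomial_function_tensor)
      (auto simp: f_def multilinear_mult_def case_prod_unfold intro!: polynomial_intros lin
        real_polynomial_function_sum)
  moreover have "open G"
    unfolding G_def case_prod_unfold
    by (intro open_Collect_conj open_Collect_neq continuous_intros)
  moreover have "((\<chi> i j. 1), (\<chi> i j. 1), (\<chi> i j. 1)) \<in> G"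
    by (simp add: G_def)
  then have "G \<noteq> {}"
    by blast
  moreover have "f X \<in> zariski closure_of R" if "X \<in> G" for X
    using that R closure_of_subset[of R zariski] by (auto simp: f_def G_def)
  ultimately have "range f \<subseteq> zariski closure_of R"
    by (rule polynomial_image_subset_zariski_closure)
  moreover have "f (U, V, W) = multilinear_mult U V W T" for U V W
    by (simp add: f_def)
  ultimately show ?thesis
    unfolding GL_orbit_def by (smt (verit, best) mem_Collect_eq rangeI subset_iff)
qed

subsection \<open>Dimensions of the orbits\<close>

lemma in_range_coord:
  assumes "T = \<Phi> (nth_default 0 xs)" and "length xs \<le> CARD('n)"
  shows "T \<in> range (\<lambda>x :: real ^ 'n. \<Phi> (coord x))"
proof -
  obtain x :: "real ^ 'n" where "coord x = nth_default 0 xs"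
    using ex_coord_eq[where 'n = 'n and v = "nth_default 0 xs"] assms(2) by (auto simp: nth_default_beyond)
  then show ?thesis
    using assms(1) by (auto intro!: range_eqI[of _ _ x])
qed

lemma polynomial_image_closure_subset:
  assumes "polynomial_function h"
  shows "h ` (zariski closure_of S) \<subseteq> zariski closure_of (h ` S)"
proof safe
  fix x assume x: "x \<in> zariski closure_of S"
  show "h x \<in> zariski closure_of (h ` S)"
    unfolding in_zariski_closure_iff
  proof (intro allI impI)
    fix p assume "real_polynomial_function p" "\<forall>s\<in>h ` S. p s = 0"
    then show "p (h x) = 0"
      using zariski_closure_subset_zeros[OF real_polynomial_function_compose[OF assms] _ x, of p]
      by simp
  qed
qed

lemma semialg_dim_zero: "semialg_dim {0 :: 'a::euclidean_space} = 0"
proof -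
  have "closedin zariski {0 :: 'a}"
  proof -
    have "{0 :: 'a} = {x. x \<bullet> x = 0}"
      by auto
    moreover have "real_polynomial_function (\<lambda>x :: 'a. x \<bullet> x)"
    proof -
      have "(\<lambda>x :: 'a. x \<bullet> x) = (\<lambda>x. \<Sum>b\<in>Basis. (x \<bullet> b) * (x \<bullet> b))"
        using euclidean_inner by (auto simp: fun_eq_iff)
      moreover have "real_polynomial_function (\<lambda>x :: 'a. \<Sum>b\<in>Basis. (x \<bullet> b) * (x \<bullet> b))"
        by (intro real_polynomial_function_sum real_polynomial_function.intros(1,4)
            bounded_linear_inner_left finite_Basis)
      ultimately show ?thesis
        by simp
    qed
    ultimately show ?thesis
      using closedin_zariski_zeros[of "\<lambda>x :: 'a. x \<bullet> x"] by simp
  qed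
  then have cl: "zariski closure_of {0 :: 'a} = {0}" "closedin zariski {0 :: 'a}"
    by (simp_all add: closure_of_closedin)
  have "n = 0" if "\<forall>i\<le>n. irreducible_closedin zariski (Z i) \<and> Z i \<subseteq> {0}"
    "\<forall>i<n. Z i \<subset> Z (Suc i)" for n and Z :: "nat \<Rightarrow> 'a set"
  proof (rule ccontr)
    assume "n \<noteq> 0"
    then have "Z 0 \<noteq> {}" "Z 0 \<subset> Z (Suc 0)" "Z (Suc 0) \<subseteq> {0}"
      using that by (auto simp: irreducible_closedin_def)
    then show False
      by blast
  qed
  then show ?thesis
    unfolding semialg_dim_def krull_dim_def cl(1) irreducible_closedin_subtopology[OF cl(2)]
    by (intro antisym Sup_least zero_le) (auto simp: zero_enat_def)
qed

lemma semialg_dim_D0: "semialg_dim D0 = 0"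
proof -
  have "D0 = {0}"
    using GL_orbit_refl[of 0] by (auto simp: D0_def GL_orbit_def multilinear_mult_def vec_eq_iff)
  then show ?thesis
    using semialg_dim_zero by metis
qed

lemma semialg_dim_D1: "semialg_dim D1 = 4"
proof -
  define \<Phi> :: "(nat \<Rightarrow> real) \<Rightarrow> tensor" where "\<Phi> v = tensor_of
    (mat22 (v 0) (v 0 * v 3) (v 0 * v 2) (v 0 * v 2 * v 3))
    (mat22 (v 0 * v 1) (v 0 * v 1 * v 3) (v 0 * v 1 * v 2) (v 0 * v 1 * v 2 * v 3))" for v
  define fs where "fs = [\<lambda>T :: tensor. T $ 1 $ 1 $ 1, \<lambda>T. T $ 2 $ 1 $ 1, \<lambda>T. T $ 1 $ 2 $ 1,
    \<lambda>T. T $ 1 $ 1 $ 2]"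
  have poly: "polynomial_function (\<lambda>x :: real ^ 4. \<Phi> (coord x))"
    by (rule polynomial_function_tensor) (auto simp: \<Phi>_def forall_2 intro!: polynomial_intros)
  have "D1 \<subseteq> zariski closure_of (range (\<lambda>x :: real ^ 4. \<Phi> (coord x)))"
    unfolding D1_def
  proof (rule GL_orbit_subset_closure_if_generic)
    fix U V W :: "real ^ 2 ^ 2"
    assume *: "U $ 1 $ 1 \<noteq> 0" "V $ 1 $ 1 \<noteq> 0" "W $ 1 $ 1 \<noteq> 0"
    have "multilinear_mult U V W (E 1 1 1) = \<Phi> (nth_default 0
        [U $ 1 $ 1 * V $ 1 $ 1 * W $ 1 $ 1, U $ 2 $ 1 / U $ 1 $ 1, V $ 2 $ 1 / V $ 1 $ 1,
          W $ 2 $ 1 / W $ 1 $ 1])"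
      using * by (simp add: \<Phi>_def vec_eq_iff forall_2 multilinear_mult_def sum_2 nth_default_def)
    then show "multilinear_mult U V W (E 1 1 1) \<in> range (\<lambda>x :: real ^ 4. \<Phi> (coord x))"
      by (rule in_range_coord) simp
  qed
  moreover have "range (\<lambda>x :: real ^ 4. \<Phi> (coord x)) \<subseteq> zariski closure_of D1"
  proof (rule range_subset_closure_if_generic[OF poly, where Q = "\<lambda>v. v 0" and v = "nth_default 0 [1]"])
    show "\<Phi> v \<in> D1" if "v 0 \<noteq> 0" for v
      using outer_product_in_D1[of "v 0" "v 0 * v 1" 1 "v 2" 1 "v 3"] that by (simp add: \<Phi>_def)
  qed (auto intro!: polynomial_intros simp: nth_default_def)
  ultimately have "semialg_dim D1 = enat CARD(4)"
  proof (rule semialg_dim_parametrization[OF poly, of _ fs])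
    show "\<forall>f\<in>set fs. real_polynomial_function f"
      by (auto simp: fs_def intro!: polynomial_intros)
    show "(fs ! k) (\<Phi> v) = 0" if "k < CARD(4)" "\<forall>i\<ge>k. v i = 0" for k v
    proof -
      have "k = 0 \<or> k = 1 \<or> k = 2 \<or> k = 3"
        using that(1) by auto
      then show ?thesis
        using that(2) by (elim disjE) (auto simp: fs_def \<Phi>_def)
    qed
    show "(fs ! k) (\<Phi> (\<lambda>i. if i \<le> k then 1 else 0)) \<noteq> 0" if "k < CARD(4)" for k
    proof -
      have "k = 0 \<or> k = 1 \<or> k = 2 \<or> k = 3"
        using that by auto
      then show ?thesis
        by (elim disjE) (simp_all add: fs_def \<Phi>_def)
    qed
  qed (simp add: fs_def)
  then show ?thesis
    by (simp add: numeral_eq_enat)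
qed

lemma semialg_dim_image_D2':
  assumes h: "polynomial_function h" and hh: "\<And>T. h (h T) = T"
  shows "semialg_dim (h ` D2') = 5"
proof -
  define \<Phi> :: "(nat \<Rightarrow> real) \<Rightarrow> tensor" where "\<Phi> v = tensor_of
    (mat22 (v 0) (v 1) (v 2) (v 3)) (mat22 (v 0 * v 4) (v 1 * v 4) (v 2 * v 4) (v 3 * v 4))" for v
  define fs where "fs = [\<lambda>T :: tensor. T $ 1 $ 1 $ 1, \<lambda>T. T $ 1 $ 1 $ 2, \<lambda>T. T $ 1 $ 2 $ 1,
    \<lambda>T. T $ 1 $ 2 $ 2, \<lambda>T. T $ 2 $ 1 $ 1]"
  have poly: "polynomial_function (\<lambda>x :: real ^ 5. \<Phi> (coord x))"
    by (rule polynomial_function_tensor) (auto simp: \<Phi>_def forall_2 intro!: polynomial_intros)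
  have polyh: "polynomial_function (\<lambda>x :: real ^ 5. h (\<Phi> (coord x)))"
    using polynomial_function_compose[OF poly h] by (simp add: o_def)
  have "D2' \<subseteq> zariski closure_of (range (\<lambda>x :: real ^ 5. \<Phi> (coord x)))"
    unfolding D2'_def
  proof (rule GL_orbit_subset_closure_if_generic)
    fix U V W :: "real ^ 2 ^ 2"
    assume *: "U $ 1 $ 1 \<noteq> 0"
    obtain s where s: "U $ 2 $ 1 = s * U $ 1 $ 1"
      using * by (metis nonzero_eq_divide_eq)
    let ?A = "\<lambda>j k. U $ 1 $ 1 * (V $ j $ 1 * W $ k $ 1 + V $ j $ 2 * W $ k $ 2)"
    have "multilinear_mult U V W (E 1 1 1 + E 1 2 2) =
        \<Phi> (nth_default 0 [?A 1 1, ?A 1 2, ?A 2 1, ?A 2 2, s])"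
      by (simp add: \<Phi>_def vec_eq_iff forall_2 multilinear_mult_def sum_2 nth_default_def s)
        (simp add: algebra_simps)
    then show "multilinear_mult U V W (E 1 1 1 + E 1 2 2) \<in> range (\<lambda>x :: real ^ 5. \<Phi> (coord x))"
      by (rule in_range_coord) simp
  qed
  then have "h ` D2' \<subseteq> zariski closure_of (range (\<lambda>x :: real ^ 5. h (\<Phi> (coord x))))"
    using polynomial_image_closure_subset[OF h, of "range (\<lambda>x :: real ^ 5. \<Phi> (coord x))"]
    by (auto simp: image_image)
  moreover have "range (\<lambda>x :: real ^ 5. h (\<Phi> (coord x))) \<subseteq> zariski closure_of (h ` D2')"
  proof (rule range_subset_closure_if_generic[OF polyh, where Q = "\<lambda>v. v 0 * v 3 - v 1 * v 2" and v = "nth_default 0 [1, 0, 0, 1]"])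
    show "h (\<Phi> v) \<in> h ` D2'" if "v 0 * v 3 - v 1 * v 2 \<noteq> 0" for v
      unfolding D2'_def
      by (intro imageI GL_orbitI[of _ "mat22 1 0 (v 4) 1" "mat22 (v 0) (v 1) (v 2) (v 3)" "mat 1"])
        (use that in \<open>auto simp: \<Phi>_def vec_eq_iff forall_2 multilinear_mult_def sum_2 mat_def
          invertible_det_nz det_2\<close>)
  qed (auto intro!: polynomial_intros simp: nth_default_def)
  ultimately have "semialg_dim (h ` D2') = enat CARD(5)"
  proof (rule semialg_dim_parametrization[OF polyh, of _ "map (\<lambda>f. f \<circ> h) fs"])
    show "\<forall>f\<in>set (map (\<lambda>f. f \<circ> h) fs). real_polynomial_function f"
      by (auto simp: fs_def intro!: real_polynomial_function_compose[OF h] polynomial_intros)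
    show "(map (\<lambda>f. f \<circ> h) fs ! k) (h (\<Phi> v)) = 0" if "k < CARD(5)" "\<forall>i\<ge>k. v i = 0" for k v
    proof -
      have "k = 0 \<or> k = 1 \<or> k = 2 \<or> k = 3 \<or> k = 4"
        using that(1) by auto
      then show ?thesis
        using that(2) by (elim disjE) (auto simp: hh fs_def \<Phi>_def)
    qed
    show "(map (\<lambda>f. f \<circ> h) fs ! k) (h (\<Phi> (\<lambda>i. if i \<le> k then 1 else 0))) \<noteq> 0" if "k < CARD(5)" for k
    proof -
      have "k = 0 \<or> k = 1 \<or> k = 2 \<or> k = 3 \<or> k = 4"
        using that by auto
      then show ?thesis
        by (elim disjE) (simp_all add: hh fs_def \<Phi>_def)
    qed
  qed (simp add: fs_def)
  then show ?thesis
    by (simp add: numeral_eq_enat)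
qed

lemma semialg_dim_D2:
  "semialg_dim D2 = 5" "semialg_dim D2' = 5" "semialg_dim D2'' = 5"
proof -
  have "polynomial_function swap12" "polynomial_function swap13"
    by (rule polynomial_function_tensor, simp add: real_polynomial_function_nth)+
  then show "semialg_dim D2 = 5" "semialg_dim D2' = 5" "semialg_dim D2'' = 5"
    using semialg_dim_image_D2'[of swap12] semialg_dim_image_D2'[of swap13]
      semialg_dim_image_D2'[of "\<lambda>T. T"]
    by (simp_all add: D2_eq_swap D2''_eq_swap)
qed

text \<open>A generic tensor in \<open>D3\<close> is \<open>x \<otimes> y \<otimes> w + x' \<otimes> y \<otimes> z + x \<otimes> y' \<otimes> z\<close> with \<open>x = (1, v 4)\<close>,
  \<open>y = (1, v 5)\<close>, \<open>z = (1, v 6)\<close>, \<open>w = (v 0, v 1)\<close>, \<open>x' = (0, v 2)\<close> and \<open>y' = (0, v 3)\<close>.\<close>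

lemma semialg_dim_D3: "semialg_dim D3 = 7"
proof -
  define \<Phi> :: "(nat \<Rightarrow> real) \<Rightarrow> tensor" where "\<Phi> v = tensor_of
    (mat22 (v 0) (v 1) (v 5 * v 0 + v 3) (v 5 * v 1 + v 3 * v 6))
    (mat22 (v 4 * v 0 + v 2) (v 4 * v 1 + v 2 * v 6)
      (v 4 * v 5 * v 0 + v 2 * v 5 + v 4 * v 3)
      (v 4 * v 5 * v 1 + v 2 * v 5 * v 6 + v 4 * v 3 * v 6))" for v
  define fs where "fs = [\<lambda>T :: tensor. T $ 1 $ 1 $ 1, \<lambda>T. T $ 1 $ 1 $ 2, \<lambda>T. T $ 2 $ 1 $ 1,
    \<lambda>T. T $ 1 $ 2 $ 1, \<lambda>T. T $ 2 $ 2 $ 1, \<lambda>T. T $ 1 $ 2 $ 2,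
    \<lambda>T. T $ 1 $ 1 $ 2 * T $ 2 $ 2 $ 2 - T $ 1 $ 2 $ 2 * T $ 2 $ 1 $ 2]"
  have poly: "polynomial_function (\<lambda>x :: real ^ 7. \<Phi> (coord x))"
    by (rule polynomial_function_tensor) (auto simp: \<Phi>_def forall_2 intro!: polynomial_intros)
  have "D3 \<subseteq> zariski closure_of (range (\<lambda>x :: real ^ 7. \<Phi> (coord x)))"
    unfolding D3_def
  proof (rule GL_orbit_subset_closure_if_generic)
    fix U V W :: "real ^ 2 ^ 2"
    assume *: "U $ 1 $ 1 \<noteq> 0" "V $ 1 $ 1 \<noteq> 0" "W $ 1 $ 2 \<noteq> 0"
    obtain s t r where str: "U $ 2 $ 1 = s * U $ 1 $ 1" "V $ 2 $ 1 = t * V $ 1 $ 1"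
        "W $ 2 $ 2 = r * W $ 1 $ 2"
      using * by (metis nonzero_eq_divide_eq)
    let ?w = "\<lambda>k. U $ 1 $ 1 * V $ 1 $ 1 * W $ k $ 1
      + (U $ 1 $ 1 * V $ 1 $ 2 + U $ 1 $ 2 * V $ 1 $ 1) * W $ k $ 2"
    have "multilinear_mult U V W (E 1 1 1 + E 1 2 2 + E 2 1 2) = \<Phi> (nth_default 0 [?w 1, ?w 2,
        V $ 1 $ 1 * W $ 1 $ 2 * (U $ 2 $ 2 - U $ 1 $ 2 * s),
        U $ 1 $ 1 * W $ 1 $ 2 * (V $ 2 $ 2 - V $ 1 $ 2 * t), s, t, r])"
      by (simp add: \<Phi>_def vec_eq_iff forall_2 multilinear_mult_def sum_2 nth_default_def str)
        (simp add: algebra_simps)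
    then show "multilinear_mult U V W (E 1 1 1 + E 1 2 2 + E 2 1 2)
        \<in> range (\<lambda>x :: real ^ 7. \<Phi> (coord x))"
      by (rule in_range_coord) simp
  qed
  moreover have "range (\<lambda>x :: real ^ 7. \<Phi> (coord x)) \<subseteq> zariski closure_of D3"
  proof (rule range_subset_closure_if_generic
      [OF poly, where Q = "\<lambda>v. v 2 * v 3 * (v 0 * v 6 - v 1)" and v = "nth_default 0 [0, 1, 1, 1]"])
    show "\<Phi> v \<in> D3" if "v 2 * v 3 * (v 0 * v 6 - v 1) \<noteq> 0" for v
      unfolding D3_def
      by (rule GL_orbitI[of _ "mat22 1 0 (v 4) (v 2)" "mat22 1 0 (v 5) (v 3)"
            "mat22 (v 0) 1 (v 1) (v 6)"])
        (use that in \<open>auto simp: \<Phi>_def vec_eq_iff forall_2 multilinear_mult_def sum_2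
          algebra_simps\<close>)
  qed (auto intro!: polynomial_intros simp: nth_default_def)
  ultimately have "semialg_dim D3 = enat CARD(7)"
  proof (rule semialg_dim_parametrization[OF poly, of _ fs])
    show "\<forall>f\<in>set fs. real_polynomial_function f"
      by (auto simp: fs_def intro!: polynomial_intros)
    show "(fs ! k) (\<Phi> v) = 0" if "k < CARD(7)" "\<forall>i\<ge>k. v i = 0" for k v
    proof -
      have "k = 0 \<or> k = 1 \<or> k = 2 \<or> k = 3 \<or> k = 4 \<or> k = 5 \<or> k = 6"
        using that(1) by auto
      then show ?thesis
        using that(2) by (elim disjE) (auto simp: fs_def \<Phi>_def algebra_simps)
    qed
    show "(fs ! k) (\<Phi> (\<lambda>i. if i \<le> k then 1 else 0)) \<noteq> 0" if "k < CARD(7)" for k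
    proof -
      have "k = 0 \<or> k = 1 \<or> k = 2 \<or> k = 3 \<or> k = 4 \<or> k = 5 \<or> k = 6"
        using that by auto
      then show ?thesis
        by (elim disjE) (simp_all add: fs_def \<Phi>_def)
    qed
  qed (simp add: fs_def)
  then show ?thesis
    by (simp add: numeral_eq_enat)
qed

lemma real_polynomial_function_hyperdet: "real_polynomial_function hyperdet"
  unfolding hyperdet_def[abs_def] det_2 by (intro polynomial_intros)

lemma semialg_dim_open:
  fixes S :: "tensor set"
  assumes S: "open U" "U \<noteq> {}" "U \<subseteq> S"
  shows "semialg_dim S = 8"
proof -
  define \<Phi> :: "(nat \<Rightarrow> real) \<Rightarrow> tensor" where
    "\<Phi> v = tensor_of (mat22 (v 0) (v 1) (v 2) (v 3)) (mat22 (v 4) (v 5) (v 6) (v 7))" for v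
  define fs where "fs = [\<lambda>T :: tensor. T $ 1 $ 1 $ 1, \<lambda>T. T $ 1 $ 1 $ 2, \<lambda>T. T $ 1 $ 2 $ 1,
    \<lambda>T. T $ 1 $ 2 $ 2, \<lambda>T. T $ 2 $ 1 $ 1, \<lambda>T. T $ 2 $ 1 $ 2, \<lambda>T. T $ 2 $ 2 $ 1, \<lambda>T. T $ 2 $ 2 $ 2]"
  have poly: "polynomial_function (\<lambda>x :: real ^ 8. \<Phi> (coord x))"
    by (rule polynomial_function_tensor) (auto simp: \<Phi>_def forall_2 intro!: polynomial_intros)
  have "T \<in> range (\<lambda>x :: real ^ 8. \<Phi> (coord x))" for T
  proof (rule in_range_coord)
    show "T = \<Phi> (nth_default 0 [T $ 1 $ 1 $ 1, T $ 1 $ 1 $ 2, T $ 1 $ 2 $ 1, T $ 1 $ 2 $ 2,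
        T $ 2 $ 1 $ 1, T $ 2 $ 1 $ 2, T $ 2 $ 2 $ 1, T $ 2 $ 2 $ 2])"
      by (simp add: \<Phi>_def vec_eq_iff forall_2 nth_default_def)
  qed simp
  then have "S \<subseteq> zariski closure_of (range (\<lambda>x :: real ^ 8. \<Phi> (coord x)))"
    using closure_of_subset[of "range (\<lambda>x :: real ^ 8. \<Phi> (coord x))" zariski] by auto
  moreover have "U \<subseteq> zariski closure_of S"
    using S(3) closure_of_subset[of S zariski] by auto
  then have "range (\<lambda>x :: real ^ 8. \<Phi> (coord x)) \<subseteq> zariski closure_of S"
    using polynomial_image_subset_zariski_closure[of "\<lambda>x. x" U S] S by auto
  ultimately have "semialg_dim S = enat CARD(8)"
  proof (rule semialg_dim_parametrization[OF poly, of _ fs])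
    show "\<forall>f\<in>set fs. real_polynomial_function f"
      by (auto simp: fs_def intro!: polynomial_intros)
    show "(fs ! k) (\<Phi> v) = 0" if "k < CARD(8)" "\<forall>i\<ge>k. v i = 0" for k v
    proof -
      have "k = 0 \<or> k = 1 \<or> k = 2 \<or> k = 3 \<or> k = 4 \<or> k = 5 \<or> k = 6 \<or> k = 7"
        using that(1) by auto
      then show ?thesis
        using that(2) by (elim disjE) (auto simp: fs_def \<Phi>_def)
    qed
    show "(fs ! k) (\<Phi> (\<lambda>i. if i \<le> k then 1 else 0)) \<noteq> 0" if "k < CARD(8)" for k
    proof -
      have "k = 0 \<or> k = 1 \<or> k = 2 \<or> k = 3 \<or> k = 4 \<or> k = 5 \<or> k = 6 \<or> k = 7"
        using that by auto
      then show ?thesis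
        by (elim disjE) (simp_all add: fs_def \<Phi>_def)
    qed
  qed (simp add: fs_def)
  then show ?thesis
    by (simp add: numeral_eq_enat)
qed

lemma semialg_dim_G: "semialg_dim G2 = 8" "semialg_dim G3 = 8"
proof -
  have "continuous_on UNIV hyperdet"
    using real_polynomial_function_hyperdet
    by (intro continuous_on_polymonial_function) (simp add: real_polynomial_function_eq)
  then have "open {T. hyperdet T > 0}" "open {T. hyperdet T < 0}"
    by (auto intro!: open_Collect_less)
  moreover have "{T. hyperdet T > 0} \<noteq> {}" "{T. hyperdet T < 0} \<noteq> {}"
    using sgn_hyperdet(2,3) GL_orbit_refl unfolding G2_def G3_def by blast+
  ultimately show "semialg_dim G2 = 8" "semialg_dim G3 = 8"
    using semialg_dim_open[of "{T. hyperdet T > 0}" G2] semialg_dim_open[of "{T. hyperdet T < 0}" G3]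
      in_G2_if_hyperdet_pos in_G3_if_hyperdet_neg by blast+
qed

theorem theorem4p3:
  shows "distinct [D0, D1, D2, D2', D2'', D3, G2, G3] \<and>
    partition_on UNIV {D0, D1, D2, D2', D2'', D3, G2, G3} \<and>
    semialg_dim D0 = 0 \<and>
    semialg_dim D1 = 4 \<and>
    semialg_dim D2 = 5 \<and> semialg_dim D2' = 5 \<and> semialg_dim D2'' = 5 \<and>
    semialg_dim D3 = 7 \<and>
    semialg_dim G2 = 8 \<and> semialg_dim G3 = 8"
  using distinct_orbits partition_orbits semialg_dim_D0 semialg_dim_D1 semialg_dim_D2
    semialg_dim_D3 semialg_dim_G by blast

end
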